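(* Let $\mathcal T_{\mathbb Z^2}$, $\mathcal T_{\mathbb H}$, $\mathcal T_{\mathbb Q}$ be the self-avoiding trees of the plane $\mathbb Z^2$, the half-plane $\mathbb H$ and the first quadrant $\mathbb Q$ respectively, and let $\mu$ be the connective constant of the lattice $\mathbb Z^2$. Then $$\lambda_c(\mathcal T_{\mathbb Z^2})=\lambda_c(\mathcal T_{\mathbb H})=\lambda_c(\mathcal T_{\mathbb Q})=\frac1\mu .$$
   Context: $\mathbb H=\{(x,y)\in\mathbb Z^2: y\ge 0\}$ and $\mathbb Q=\{(x,y)\in\mathbb Z^2: x\ge 0,\ y\ge 0\}$, with nearest-neighbour edges. A self-avoiding walk (SAW) of length $n$ is a nearest-neighbour path $(\gamma_0,\dots,\gamma_n)$ visiting no vertex more than once. For $G\in\{\mathbb Z^2,\mathbb H,\mathbb Q\}$, the self-avoiding tree $\mathcal T_G$ is the tree whose vertices are the finite self-avoiding walks in $G$ starting at the origin $(0,0)$, two being adjacent when one is a one-step extension of the other; its root is the walk of length $0$. Connective constant: $\mu=\lim_{n\to\infty}c_n^{1/n}$, where $c_n$ is the number of SAWs of length $n$ in $\mathbb Z^2$ starting at the origin. Biased random walk: for $\lambda>0$ and an infinite, locally finite rooted tree $\mathcal T$ with root $o$, $RW_\lambda$ is the Markov chain on the vertices of $\mathcal T$ which, at a vertex $x\ne o$ with $k$ children, jumps to the parent of $x$ with probability $1/(1+k\lambda)$ and to each child with probability $\lambda/(1+k\lambda)$; from $o$ it jumps to a uniformly chosen child. The critical value $\lambda_c(\mathcal T)$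 is the value such that $RW_\lambda$ is recurrent for $\lambda<\lambda_c(\mathcal T)$ and transient for $\lambda>\lambda_c(\mathcal T)$; equivalently (Lyons) $\lambda_c(\mathcal T)=1/br(\mathcal T)$, where $br(\mathcal T)=\sup\{\lambda\ge 1:\inf_{\pi}\sum_{e\in\pi}\lambda^{-|e|}>0\}$, the infimum being over sets $\pi$ of edges separating the root from infinity (every infinite simple path from the root uses an edge of $\pi$), and $|e|$ being the distance from the root to the endpoint of $e$ farthest from the root. *)

theory Defs
  imports "HOL-Probability.Probability"
begin

section \<open>Rooted trees\<close>

text \<open>
  A rooted tree is given by its vertices, its root, and the map sending each vertex other than the
  root to its parent (the value of this map at the root is irrelevant). Two vertices are adjacent
  when one is the parent of the other.
\<close>

record 'v rtree =
  tverts :: "'v set"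
  troot :: 'v
  tparent :: "'v \<Rightarrow> 'v"

locale rooted_tree =
  fixes T :: "'v rtree"
  assumes root_in: "troot T \<in> tverts T"
    and parent_in: "\<And>x. x \<in> tverts T \<Longrightarrow> x \<noteq> troot T \<Longrightarrow> tparent T x \<in> tverts T"
    and reaches_root: "\<And>x. x \<in> tverts T \<Longrightarrow> \<exists>n. (tparent T ^^ n) x = troot T"

definition children :: "'v rtree \<Rightarrow> 'v \<Rightarrow> 'v set" where
  "children T x = {y \<in> tverts T. y \<noteq> troot T \<and> tparent T y = x}"

definition locally_finite_tree :: "'v rtree \<Rightarrow> bool" where
  "locally_finite_tree T \<longleftrightarrow> (\<forall>x \<in> tverts T. finite (children T x))"

definition infinite_tree :: "'v rtree \<Rightarrow> bool" where
  "infinite_tree T \<longleftrightarrow> infinite (tverts T)"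

lemma (in rooted_tree) parent_notin_children:
  assumes x: "x \<in> tverts T" "x \<noteq> troot T"
  shows "tparent T x \<notin> children T x"
proof
  assume a: "tparent T x \<in> children T x"
  have "(tparent T ^^ n) x \<in> {x, tparent T x}" for n
    using a by (induction n) (auto simp: children_def)
  moreover have "troot T \<notin> {x, tparent T x}"
    using a x by (auto simp: children_def)
  ultimately show False
    using reaches_root[OF x(1)] by metis
qed

lemma (in rooted_tree) children_root_nonempty:
  assumes "infinite_tree T"
  shows "children T (troot T) \<noteq> {}"
proof
  assume e: "children T (troot T) = {}"
  have *: "x = troot T" if "x \<in> tverts T" "(tparent T ^^ n) x = troot T" for x n
    using that
  proof (induction n arbitrary: x)
    case 0
    then show ?case by simp
  next
    case (Suc n)
    show ?case
    proof (rule ccontr)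
      assume "x \<noteq> troot T"
      moreover from this have "tparent T x = troot T"
        using Suc parent_in by (metis comp_apply funpow_Suc_right)
      ultimately show False
        using Suc.prems e by (auto simp: children_def)
    qed
  qed
  then have "tverts T \<subseteq> {troot T}"
    using reaches_root by blast
  then show False
    using assms finite_subset unfolding infinite_tree_def by blast
qed

section \<open>The biased random walk and its critical value\<close>

definition rw_step :: "'v rtree \<Rightarrow> real \<Rightarrow> 'v \<Rightarrow> 'v pmf" where
  "rw_step T l x =
     (if x = troot T then pmf_of_set (children T x)
      else embed_pmf (\<lambda>y.
        let k = real (card (children T x)) in
        if y = tparent T x then 1 / (1 + k * l)
        else if y \<in> children T x then l / (1 + k * l)
        else 0))"

text \<open>The density used in \<^const>\<open>rw_step\<close> is a genuine probability mass function.\<close>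

lemma (in rooted_tree) pmf_rw_step:
  assumes fin: "locally_finite_tree T" and l: "l > 0"
    and x: "x \<in> tverts T" "x \<noteq> troot T"
  defines "k \<equiv> real (card (children T x))"
  shows "pmf (rw_step T l x) y =
    (if y = tparent T x then 1 / (1 + k * l)
     else if y \<in> children T x then l / (1 + k * l) else 0)"
proof -
  define f where "f = (\<lambda>y. if y = tparent T x then 1 / (1 + k * l)
     else if y \<in> children T x then l / (1 + k * l) else 0)"
  let ?A = "insert (tparent T x) (children T x)"
  have k: "k \<ge> 0" by (simp add: k_def)
  then have pos: "1 + k * l > 0"
    using l by (simp add: add_pos_nonneg)
  have nn: "f y \<ge> 0" for y
    using pos l by (auto simp: f_def)
  have finC: "finite (children T x)"
    using fin x by (simp add: locally_finite_tree_def)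
  have "sum f (children T x) = sum (\<lambda>_. l / (1 + k * l)) (children T x)"
    using parent_notin_children[OF x] by (intro sum.cong) (auto simp: f_def)
  then have "sum f ?A = 1 / (1 + k * l) + k * (l / (1 + k * l))"
    using parent_notin_children[OF x] finC by (simp add: f_def k_def)
  also have "\<dots> = 1"
    using pos by (simp add: add_divide_distrib[symmetric])
  finally have s: "sum f ?A = 1" .
  have "(\<integral>\<^sup>+y. ennreal (f y) \<partial>count_space UNIV) = (\<Sum>y\<in>?A. ennreal (f y))"
    using finC by (intro nn_integral_count_space') (auto simp: f_def)
  also have "\<dots> = 1"
    using s nn by (subst sum_ennreal) auto
  finally have "pmf (embed_pmf f) y = f y"
    by (intro pmf_embed_pmf nn)
  moreover have "rw_step T l x = embed_pmf f"
    using x unfolding rw_step_def f_def k_def Let_def by simp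
  ultimately show ?thesis
    by (simp add: f_def)
qed

text \<open>
  The law of the trajectory of the walk started at the root, on the space of all sequences of
  vertices, is obtained from the one-step distributions by the Ionescu-Tulcea theorem:
  \<^term>\<open>rw_kernel T l n w\<close> is the distribution of the position at time \<^term>\<open>n\<close> given the past.
\<close>

definition rw_kernel :: "'v rtree \<Rightarrow> real \<Rightarrow> nat \<Rightarrow> (nat \<Rightarrow> 'v) \<Rightarrow> 'v measure" where
  "rw_kernel T l n w =
     measure_pmf (if n = 0 then return_pmf (troot T) else rw_step T l (w (n - 1)))"

definition rw_law :: "'v rtree \<Rightarrow> real \<Rightarrow> (nat \<Rightarrow> 'v) measure" where
  "rw_law T l =
     projective_family.lim UNIV
       (Ionescu_Tulcea.CI (rw_kernel T l) (\<lambda>_. count_space UNIV)) (\<lambda>_. count_space UNIV)"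

lemma Ionescu_Tulcea_rw:
  fixes T :: "'a rtree"
  shows "Ionescu_Tulcea (rw_kernel T l) (\<lambda>_. count_space UNIV)"
proof (rule Ionescu_Tulcea.intro)
  fix n :: nat
  show "rw_kernel T l n \<in>
      PiM {0..<n} (\<lambda>_. count_space UNIV) \<rightarrow>\<^sub>M subprob_algebra (count_space UNIV)"
  proof (cases "n = 0")
    case True
    then show ?thesis
      by (simp add: rw_kernel_def[abs_def] measure_pmf_in_subprob_algebra)
  next
    case False
    have "(\<lambda>w. measure_pmf (rw_step T l (w (n - 1)))) \<in>
        PiM {0..<n} (\<lambda>_. count_space UNIV) \<rightarrow>\<^sub>M subprob_algebra (count_space UNIV)"
    proof (rule measurable_compose[where f = "\<lambda>w. w (n - 1)" and N = "count_space UNIV"])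
      show "(\<lambda>w. w (n - 1)) \<in> PiM {0..<n} (\<lambda>_. count_space UNIV) \<rightarrow>\<^sub>M count_space UNIV"
        using False by (intro measurable_component_singleton) auto
      show "(\<lambda>x. measure_pmf (rw_step T l x)) \<in>
          count_space UNIV \<rightarrow>\<^sub>M subprob_algebra (count_space UNIV)"
        by (auto simp: measure_pmf_in_subprob_algebra)
    qed
    then show ?thesis
      using False by (simp add: rw_kernel_def[abs_def])
  qed
next
  fix n :: nat and w :: "nat \<Rightarrow> 'a"
  show "prob_space (rw_kernel T l n w)"
    by (auto simp: rw_kernel_def intro: prob_space_measure_pmf)
qed

definition rw_recurrent :: "'v rtree \<Rightarrow> real \<Rightarrow> bool" where
  "rw_recurrent T l \<longleftrightarrow> (AE w in rw_law T l. \<exists>n\<ge>1. w n = troot T)"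

definition rw_transient :: "'v rtree \<Rightarrow> real \<Rightarrow> bool" where
  "rw_transient T l \<longleftrightarrow> \<not> rw_recurrent T l"

text \<open>
  Only the biases \<^prop>\<open>l > 0\<close> are meaningful; the condition \<^prop>\<open>0 \<le> c\<close> makes the value unique.
\<close>

definition is_critical_value :: "'v rtree \<Rightarrow> real \<Rightarrow> bool" where
  "is_critical_value T c \<longleftrightarrow> 0 \<le> c \<and>
     (\<forall>l>0. (l < c \<longrightarrow> rw_recurrent T l) \<and> (c < l \<longrightarrow> rw_transient T l))"

definition critical_value :: "'v rtree \<Rightarrow> real" where
  "critical_value T = (THE c. is_critical_value T c)"

lemma is_critical_value_unique:
  assumes "is_critical_value T c" "is_critical_value T d"
  shows "c = d"
proof -
  have False if "is_critical_value T a" "is_critical_value T b" "a < b" for a b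
  proof -
    obtain l where "a < l" "l < b"
      using dense \<open>a < b\<close> by blast
    moreover have "0 \<le> a"
      using that by (simp add: is_critical_value_def)
    ultimately have "rw_recurrent T l" "rw_transient T l"
      using \<open>is_critical_value T a\<close> \<open>is_critical_value T b\<close>
      unfolding is_critical_value_def by (meson le_less_trans)+
    then show False
      by (simp add: rw_transient_def)
  qed
  then show ?thesis
    using assms by (metis linorder_neqE_linordered_idom)
qed

lemma critical_value_eqI: "is_critical_value T c \<Longrightarrow> critical_value T = c"
  unfolding critical_value_def by (blast intro: is_critical_value_unique)

section \<open>Self-avoiding walks and self-avoiding trees\<close>

text \<open>The set \<^term>\<open>G\<close> of lattice points stands for the subgraph of the square lattice it induces.\<close>

definition half_plane :: "(int \<times> int) set" where
  "half_plane = {(x, y). y \<ge> 0}"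

definition quadrant :: "(int \<times> int) set" where
  "quadrant = {(x, y). x \<ge> 0 \<and> y \<ge> 0}"

definition lattice_adj :: "int \<times> int \<Rightarrow> int \<times> int \<Rightarrow> bool" where
  "lattice_adj u v \<longleftrightarrow> \<bar>fst u - fst v\<bar> + \<bar>snd u - snd v\<bar> = 1"

text \<open>
  A walk is represented by the nonempty list of its vertices, so a walk of length \<open>n\<close> is a list
  with \<open>n + 1\<close> entries.
\<close>

definition saws :: "(int \<times> int) set \<Rightarrow> (int \<times> int) list set" where
  "saws G = {p. p \<noteq> [] \<and> hd p = (0, 0) \<and> set p \<subseteq> G \<and> distinct p \<and> successively lattice_adj p}"

definition saw_count :: "nat \<Rightarrow> nat" where
  "saw_count n = card {p \<in> saws UNIV. length p = n + 1}"

definition connective_constant :: real where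
  "connective_constant = lim (\<lambda>n. root n (real (saw_count n)))"

definition saw_tree :: "(int \<times> int) set \<Rightarrow> (int \<times> int) list rtree" where
  "saw_tree G = \<lparr>tverts = saws G, troot = [(0, 0)], tparent = butlast\<rparr>"

lemma saw_tree_simps [simp]:
  "tverts (saw_tree G) = saws G" "troot (saw_tree G) = [(0, 0)]" "tparent (saw_tree G) = butlast"
  by (simp_all add: saw_tree_def)

lemma saws_singleton_iff: "p \<in> saws G \<Longrightarrow> p = [(0, 0)] \<longleftrightarrow> length p = 1"
  by (cases p) (auto simp: saws_def)

lemma butlast_in_saws:
  assumes p: "p \<in> saws G" "p \<noteq> [(0, 0)]"
  shows "butlast p \<in> saws G"
proof -
  obtain q v where q: "p = q @ [v]"
    using p by (cases p rule: rev_cases) (auto simp: saws_def)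
  moreover have "q \<noteq> []"
    using p q by (auto simp: saws_def)
  ultimately show ?thesis
    using p by (auto simp: saws_def successively_append_iff)
qed

lemma rooted_tree_saw_tree:
  assumes "(0, 0) \<in> G"
  shows "rooted_tree (saw_tree G)"
proof
  show "troot (saw_tree G) \<in> tverts (saw_tree G)"
    using assms by (simp add: saws_def)
  show "tparent (saw_tree G) x \<in> tverts (saw_tree G)"
    if "x \<in> tverts (saw_tree G)" "x \<noteq> troot (saw_tree G)" for x
    using that butlast_in_saws by simp
  show "\<exists>n. (tparent (saw_tree G) ^^ n) x = troot (saw_tree G)"
    if "x \<in> tverts (saw_tree G)" for x
  proof -
    have "\<exists>n. (butlast ^^ n) p = [(0, 0)]" if "length p = Suc m" "p \<in> saws G" for m p
      using that
    proof (induction m arbitrary: p)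
      case 0
      then have "p = [(0, 0)]"
        using saws_singleton_iff by simp
      then show ?case
        by (intro exI[of _ 0]) simp
    next
      case (Suc m)
      then have "p \<noteq> [(0, 0)]" by auto
      then obtain n where "(butlast ^^ n) (butlast p) = [(0, 0)]"
        using Suc butlast_in_saws[of p G] by fastforce
      then show ?case
        by (intro exI[of _ "Suc n"]) (simp add: funpow_Suc_right del: funpow.simps)
    qed
    moreover have "x \<noteq> []"
      using that by (simp add: saws_def)
    ultimately show ?thesis
      using that by (cases x) auto
  qed
qed

lemma children_saw_tree:
  assumes "p \<in> saws G"
  shows "children (saw_tree G) p =
    {p @ [v] | v. v \<in> G \<and> v \<notin> set p \<and> lattice_adj (last p) v}"
proof (intro equalityI subsetI)
  fix q
  assume "q \<in> children (saw_tree G) p"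
  then have q: "q \<in> saws G" "q \<noteq> [(0, 0)]" "butlast q = p"
    by (auto simp: children_def)
  then obtain v where "q = p @ [v]"
    by (cases q rule: rev_cases) (auto simp: saws_def)
  moreover from this have "v \<in> G" "v \<notin> set p" "lattice_adj (last p) v"
    using q assms by (auto simp: saws_def successively_append_iff)
  ultimately show "q \<in> {p @ [v] | v. v \<in> G \<and> v \<notin> set p \<and> lattice_adj (last p) v}"
    by blast
next
  fix q
  assume "q \<in> {p @ [v] | v. v \<in> G \<and> v \<notin> set p \<and> lattice_adj (last p) v}"
  then show "q \<in> children (saw_tree G) p"
    using assms by (auto simp: children_def saws_def successively_append_iff)
qed

lemma finite_lattice_adj: "finite {v. lattice_adj u v}"
proof (rule finite_subset)
  show "{v. lattice_adj u v} \<subseteq> {fst u - 1..fst u + 1} \<times> {snd u - 1..snd u + 1}"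
    by (auto simp: lattice_adj_def)
qed simp

lemma locally_finite_saw_tree: "locally_finite_tree (saw_tree G)"
  unfolding locally_finite_tree_def
proof
  fix p
  assume "p \<in> tverts (saw_tree G)"
  then have "children (saw_tree G) p \<subseteq> (\<lambda>v. p @ [v]) ` {v. lattice_adj (last p) v}"
    by (auto simp: children_saw_tree)
  then show "finite (children (saw_tree G) p)"
    using finite_lattice_adj finite_surj by blast
qed

lemma infinite_saw_tree:
  assumes "quadrant \<subseteq> G"
  shows "infinite_tree (saw_tree G)"
proof -
  define w where "w n = map (\<lambda>i. (int i, 0 :: int)) [0..<Suc n]" for n
  have "w n \<in> saws G" for n
  proof -
    have "successively lattice_adj (w n)"
      by (auto simp: w_def successively_conv_nth lattice_adj_def simp del: upt_Suc)
    moreover have "distinct (w n)"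
      by (auto simp: w_def distinct_map inj_on_def simp del: upt_Suc)
    moreover have "set (w n) \<subseteq> G"
      using assms by (auto simp: w_def quadrant_def simp del: upt_Suc)
    moreover have "hd (w n) = (0, 0)"
      by (simp add: w_def hd_map del: upt_Suc)
    moreover have "w n \<noteq> []"
      by (simp add: w_def)
    ultimately show ?thesis
      by (simp add: saws_def)
  qed
  moreover have "inj w"
    by (rule inj_on_inverseI[where g = "\<lambda>p. length p - 1"]) (simp add: w_def)
  ultimately show ?thesis
    unfolding infinite_tree_def saw_tree_simps
    by (meson image_subsetI infinite_iff_countable_subset)
qed

end

theory Submission
  imports Defs
begin

text \<open>
  For biases \<open>l < 1 / \<mu>\<close>, let \<open>h x\<close> be the probability that the walk started at \<open>x\<close> never hits the root.
  Since \<open>h\<close> is harmonic off the root, its gradient weighted by the conductances \<open>l ^ n\<close> is a flow with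
  the same strength through every level of the tree; the total conductance of level \<open>n\<close> is at most
  \<open>c\<^sub>n * l ^ n\<close>, which tends to \<open>0\<close>, so the flow vanishes and the walk is recurrent.

  For \<open>l > 1 / \<mu>\<close>, transience follows from a bounded subharmonic function vanishing at the root, and such
  a function is the potential of a suitable flow. The Hammersley--Welsh decomposition shows that
  self-avoiding bridges have the same exponential growth rate \<open>\<mu>\<close> as self-avoiding walks; by reflection
  at least half of the bridges of length \<open>N\<close> end at nonnegative height. After \<open>N\<close> initial steps upwards these
  can be concatenated freely without leaving the quadrant, and for suitable \<open>N\<close> the uniform flow through
  all concatenations has a bounded potential. A flow in the tree of the quadrant is also a flow in the
  larger trees.
\<close>

section \<open>The probability of avoiding the root\<close>

text \<open>Probability that the walk from \<open>x\<close> is not at the root at any of the times 1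
  to \<open>n\<close>. Time 0 is not tested, so at \<open>x = troot T\<close> this is the
  probability of no return up to time \<open>n\<close>.\<close>

primrec avoid :: "'v rtree \<Rightarrow> real \<Rightarrow> nat \<Rightarrow> 'v \<Rightarrow> real" where
  "avoid T l 0 x = 1"
| "avoid T l (Suc n) x =
     measure_pmf.expectation (rw_step T l x) (\<lambda>y. if y = troot T then 0 else avoid T l n y)"

lemma expectation_pmf_unit_interval:
  fixes p :: "'a pmf" and f :: "'a \<Rightarrow> real"
  assumes "\<And>y. 0 \<le> f y" "\<And>y. f y \<le> 1"
  shows "integrable (measure_pmf p) f"
    and "0 \<le> measure_pmf.expectation p f" "measure_pmf.expectation p f \<le> 1"
proof -
  show i: "integrable (measure_pmf p) f"
    using assms by (intro measure_pmf.integrable_const_bound[where B=1]) auto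
  show "0 \<le> measure_pmf.expectation p f"
    using assms by (intro integral_nonneg_AE) auto
  show "measure_pmf.expectation p f \<le> 1"
    using assms by (intro measure_pmf.integral_le_const i) auto
qed

lemma avoid_nonneg_le_1: "0 \<le> avoid T l n x \<and> avoid T l n x \<le> 1"
proof (induction n arbitrary: x)
  case (Suc n)
  then show ?case
    by (auto intro!: expectation_pmf_unit_interval)
qed simp

lemmas avoid_nonneg = avoid_nonneg_le_1[THEN conjunct1]
  and avoid_le_1 = avoid_nonneg_le_1[THEN conjunct2]

lemma avoid_Suc_le: "avoid T l (Suc n) x \<le> avoid T l n x"
proof (induction n arbitrary: x)
  case 0
  then show ?case
    using avoid_le_1[of T l "Suc 0"] by simp
next
  case (Suc n)
  show ?case
    unfolding avoid.simps(2)[of T l "Suc n"] avoid.simps(2)[of T l n x]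
    by (intro integral_mono expectation_pmf_unit_interval)
       (auto simp: avoid_nonneg avoid_le_1 simp del: avoid.simps intro: Suc)
qed

text \<open>One-step operator of the walk killed on entering the root, with values in
  \<open>ennreal\<close> so that it can be iterated on arbitrary functions without integrability
  conditions.\<close>

definition killed_step :: "'v rtree \<Rightarrow> real \<Rightarrow> ('v \<Rightarrow> ennreal) \<Rightarrow> 'v \<Rightarrow> ennreal" where
  "killed_step T l f x = (\<integral>\<^sup>+y. (if y = troot T then 0 else f y) \<partial>measure_pmf (rw_step T l x))"

lemma killed_step_avoid: "(killed_step T l ^^ n) (\<lambda>_. 1) x = ennreal (avoid T l n x)"
proof (induction n arbitrary: x)
  case (Suc n)
  have "(killed_step T l ^^ Suc n) (\<lambda>_. 1) x =
    (\<integral>\<^sup>+y. ennreal (if y = troot T then 0 else avoid T l n y) \<partial>measure_pmf (rw_step T l x))"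
    by (simp add: killed_step_def) (intro nn_integral_cong, auto simp: Suc)
  also have "\<dots> = ennreal (avoid T l (Suc n) x)"
    unfolding avoid.simps
    by (intro nn_integral_eq_integral expectation_pmf_unit_interval)
       (auto simp: avoid_nonneg avoid_le_1)
  finally show ?case .
qed simp

section \<open>The law of the trajectory and the probability of no return\<close>

context
  fixes T :: "'v rtree" and l :: real
begin

interpretation IT: Ionescu_Tulcea "rw_kernel T l" "\<lambda>_. count_space UNIV"
  by (rule Ionescu_Tulcea_rw)

lemma space_PiM_count_space_0:
  "(\<lambda>_. undefined) \<in> space (PiM {0..<0::nat} (\<lambda>_. count_space (UNIV :: 'v set)))"
  by (simp add: space_PiM)

lemma measurable_coordinate:
  assumes "i \<in> I"
  shows "(\<lambda>w. f (w i)) \<in> PiM I (\<lambda>_::nat. count_space (UNIV :: 'v set)) \<rightarrow>\<^sub>M borel"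
  by (rule measurable_compose[OF measurable_component_singleton[OF assms], where g = f]) simp

text \<open>Integrating out the last coordinate replaces \<open>f\<close> by
  \<open>killed_step T l f\<close>, hence the induction with \<open>f\<close> arbitrary. The product
  is the indicator of not visiting the root; it starts at time 1 because the walk sits at the root
  at time 0.\<close>

lemma nn_integral_rw_C:
  fixes f :: "'v \<Rightarrow> ennreal"
  shows "(\<integral>\<^sup>+w. (\<Prod>k\<in>{1..n}. if w k = troot T then 0 else 1) * f (w n) \<partial>IT.C 0 (Suc n) (\<lambda>_. undefined))
    = (killed_step T l ^^ n) f (troot T)"
proof (induction n arbitrary: f)
  case 0
  have "(\<lambda>w. f (w 0)) \<in> borel_measurable (PiM {0..<Suc 0} (\<lambda>_::nat. count_space (UNIV :: 'v set)))"
    by (rule measurable_coordinate) simp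
  moreover have "IT.C 0 (Suc 0) (\<lambda>_. undefined) = IT.eP 0 (\<lambda>_. undefined)"
    by (simp only: IT.C.simps add_0 bind_return[OF IT.measurable_eP space_PiM_count_space_0])
  ultimately show ?case
    using space_PiM_count_space_0
    by (simp add: IT.nn_integral_eP del: IT.C.simps) (simp add: rw_kernel_def)
next
  case (Suc n)
  let ?I = "\<lambda>m w. (\<Prod>k\<in>{1..m}. if w k = troot T then 0 else (1 :: ennreal))"
  let ?u = "\<lambda>_::nat. undefined :: 'v"
  have meas: "(\<lambda>w. ?I m w * g (w m)) \<in> borel_measurable (PiM {0..<Suc m} (\<lambda>_. count_space UNIV))"
    for m and g :: "'v \<Rightarrow> ennreal"
    by (intro borel_measurable_times_ennreal borel_measurable_prod_ennreal
        measurable_coordinate[where f = "\<lambda>x. if x = troot T then 0 else 1"]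
        measurable_coordinate[where f = g]) auto
  have sp: "space (IT.C 0 (Suc n) ?u) = space (PiM {0..<Suc n} (\<lambda>_. count_space UNIV))"
    using IT.space_C[OF space_PiM_count_space_0, of "Suc n"] by simp
  have se: "sets (IT.C 0 (Suc n) ?u) = sets (PiM {0..<Suc n} (\<lambda>_. count_space UNIV))"
    using IT.sets_C[OF space_PiM_count_space_0, of "Suc n"] by simp
  have "(\<integral>\<^sup>+w. ?I (Suc n) w * f (w (Suc n)) \<partial>IT.C 0 (Suc (Suc n)) ?u) =
    (\<integral>\<^sup>+v. (\<integral>\<^sup>+w. ?I (Suc n) w * f (w (Suc n)) \<partial>IT.eP (Suc n) v) \<partial>IT.C 0 (Suc n) ?u)"
    unfolding IT.C.simps(2)[of 0 "Suc n"] add_0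
    by (intro nn_integral_bind[where B = "PiM {0..<Suc (Suc n)} (\<lambda>_. count_space UNIV)"] meas)
       (simp add: measurable_cong_sets[OF se refl] IT.measurable_eP del: IT.C.simps)
  also have "\<dots> = (\<integral>\<^sup>+v. ?I n v * killed_step T l f (v n) \<partial>IT.C 0 (Suc n) ?u)"
  proof (intro nn_integral_cong)
    fix v assume "v \<in> space (IT.C 0 (Suc n) ?u)"
    then have v: "v \<in> space (PiM {0..<Suc n} (\<lambda>_. count_space (UNIV :: 'v set)))"
      using sp by simp
    \<comment> \<open>The factors up to \<open>n\<close> do not see the new coordinate, so only the
      last factor takes part in the integration over the new step.\<close>
    have *: "?I (Suc n) (v(Suc n := x)) = ?I n v * (if x = troot T then 0 else 1)" for x
    proof -
      have "?I n (v(Suc n := x)) = ?I n v"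
        by (intro prod.cong) auto
      then show ?thesis
        by simp
    qed
    have "(\<integral>\<^sup>+w. ?I (Suc n) w * f (w (Suc n)) \<partial>IT.eP (Suc n) v) =
      (\<integral>\<^sup>+x. ?I n v * (if x = troot T then 0 else f x) \<partial>measure_pmf (rw_step T l (v n)))"
      by (subst IT.nn_integral_eP[OF v meas], unfold *)
         (auto simp: rw_kernel_def intro!: nn_integral_cong)
    then show "(\<integral>\<^sup>+w. ?I (Suc n) w * f (w (Suc n)) \<partial>IT.eP (Suc n) v) = ?I n v * killed_step T l f (v n)"
      by (simp add: killed_step_def nn_integral_cmult)
  qed
  also have "\<dots> = (killed_step T l ^^ Suc n) f (troot T)"
    unfolding Suc by (simp add: funpow_Suc_right del: funpow.simps)
  finally show ?case .
qed

text \<open>The event depends on the coordinates 0 to \<open>n\<close> only. It is therefore a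
  cylinder, on which the projective limit agrees with the finite-dimensional law
  \<open>IT.C 0 (Suc n)\<close>.\<close>

lemma emeasure_rw_law_avoid:
  "emeasure (rw_law T l) {w. \<forall>k\<in>{1..n}. w k \<noteq> troot T} = ennreal (avoid T l n (troot T))"
proof -
  let ?M = "\<lambda>I. PiM I (\<lambda>_::nat. count_space (UNIV :: 'v set))"
  let ?J = "{0..<Suc n}" and ?u = "\<lambda>_::nat. undefined :: 'v"
  let ?P = "\<lambda>w. \<forall>k\<in>{1..n}. w k \<noteq> troot T"
  define X where "X = {w \<in> space (?M ?J). ?P w}"
  have X: "X \<in> sets (?M ?J)"
  proof -
    have "Measurable.pred (?M ?J) ?P"
      by (intro pred_intros_finite measurable_compose[OF measurable_component_singleton,
            where g = "\<lambda>v. v \<noteq> troot T"]) auto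
    then show ?thesis unfolding X_def by simp
  qed
  have "{w. ?P w} = prod_emb UNIV (\<lambda>_. count_space UNIV) ?J X"
    by (auto simp: X_def prod_emb_def space_PiM PiE_iff)
  then have "emeasure (rw_law T l) {w. ?P w} = emeasure (IT.CI ?J) X"
    unfolding rw_law_def using IT.lim[OF _ X] by simp
  also have "\<dots> = emeasure (IT.C 0 (Suc n) ?u) X"
    using sets.sets_into_space[OF X]
    by (subst IT.emeasure_CI[OF order.refl X]) (simp add: prod_emb_id space_PiM del: IT.C.simps)
  also have "\<dots> = (\<integral>\<^sup>+w. indicator X w \<partial>IT.C 0 (Suc n) ?u)"
    using X IT.sets_C[OF space_PiM_count_space_0, of "Suc n"] by (simp del: IT.C.simps)
  also have "\<dots> = (\<integral>\<^sup>+w. (\<Prod>k\<in>{1..n}. if w k = troot T then 0 else 1) * (\<lambda>_. 1) (w n)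
      \<partial>IT.C 0 (Suc n) ?u)"
  proof (intro nn_integral_cong)
    fix w assume "w \<in> space (IT.C 0 (Suc n) ?u)"
    then have "w \<in> space (?M ?J)"
      using IT.space_C[OF space_PiM_count_space_0, of "Suc n"] by simp
    then show "indicator X w = (\<Prod>k\<in>{1..n}. if w k = troot T then 0 else 1) * (1 :: ennreal)"
      by (cases "?P w") (auto simp: X_def indicator_def prod_zero_iff)
  qed
  also have "\<dots> = ennreal (avoid T l n (troot T))"
    using nn_integral_rw_C[of n "\<lambda>_. 1"] by (simp add: killed_step_avoid del: IT.C.simps)
  finally show ?thesis .
qed

text \<open>The events of no return up to time \<open>n\<close> decrease to the event of no return
  at all; continuity from above does the rest.\<close>

lemma rw_recurrent_iff_avoid: "rw_recurrent T l \<longleftrightarrow> (\<lambda>n. avoid T l n (troot T)) \<longlonglongrightarrow> 0"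
proof -
  let ?A = "\<lambda>n. {w. \<forall>k\<in>{1..n}. w k \<noteq> troot T}"
  have space: "space (rw_law T l) = UNIV"
    by (simp add: rw_law_def IT.PF.space_lim space_PiM)
  have sets: "sets (rw_law T l) = sets (PiM UNIV (\<lambda>_::nat. count_space (UNIV :: 'v set)))"
    by (simp add: rw_law_def IT.PF.sets_lim)
  have meas: "?A n \<in> sets (rw_law T l)" for n
  proof -
    have "Measurable.pred (PiM UNIV (\<lambda>_::nat. count_space (UNIV :: 'v set)))
        (\<lambda>w. \<forall>k\<in>{1..n}. w k \<noteq> troot T)"
      by (intro pred_intros_finite measurable_compose[OF measurable_component_singleton,
            where g = "\<lambda>v. v \<noteq> troot T"]) auto
    then show ?thesis
      unfolding sets by (simp add: pred_def space_PiM)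
  qed
  have lim: "(\<lambda>n. emeasure (rw_law T l) (?A n)) \<longlonglongrightarrow> emeasure (rw_law T l) (\<Inter>n. ?A n)"
  proof (rule Lim_emeasure_decseq)
    show "emeasure (rw_law T l) (?A n) \<noteq> \<infinity>" for n
      by (subst emeasure_rw_law_avoid) simp
  qed (use meas in \<open>auto simp: decseq_def\<close>)
  have "rw_recurrent T l \<longleftrightarrow> emeasure (rw_law T l) (\<Inter>n. ?A n) = 0"
  proof -
    have eq: "(\<Inter>n. ?A n) = {w \<in> space (rw_law T l). \<not> (\<exists>n\<ge>1. w n = troot T)}"
      by (auto simp: space Ball_def)
    have A: "(\<Inter>n. ?A n) \<in> sets (rw_law T l)"
      using meas by (intro sets.countable_INT) auto
    show ?thesis
      unfolding rw_recurrent_def by (rule AE_iff_measurable[OF A eq[symmetric]])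
  qed
  also have "\<dots> \<longleftrightarrow> (\<lambda>n. emeasure (rw_law T l) (?A n)) \<longlonglongrightarrow> 0"
    using lim LIMSEQ_unique[OF lim, of 0] by fastforce
  also have "\<dots> \<longleftrightarrow> (\<lambda>n. avoid T l n (troot T)) \<longlonglongrightarrow> 0"
    unfolding emeasure_rw_law_avoid ennreal_0[symmetric]
    by (intro tendsto_ennreal_iff) (auto simp: avoid_nonneg)
  finally show ?thesis .
qed

end

section \<open>Criteria for recurrence and transience\<close>

text \<open>By monotonicity the limit exists: \<open>g x\<close> is the probability that the walk
  from \<open>x\<close> never visits the root after time 0.\<close>

lemma avoid_limit:
  obtains g where "\<And>x. (\<lambda>n. avoid T l n x) \<longlonglongrightarrow> g x" "\<And>x. 0 \<le> g x" "\<And>x. g x \<le> 1"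
proof -
  have "convergent (\<lambda>n. avoid T l n x)" for x
    by (intro Bseq_monoseq_convergent BseqI'[where K = 1] decseq_imp_monoseq decseq_SucI avoid_Suc_le)
       (simp add: avoid_nonneg avoid_le_1)
  then have lim: "(\<lambda>n. avoid T l n x) \<longlonglongrightarrow> lim (\<lambda>n. avoid T l n x)" for x
    by (simp add: convergent_LIMSEQ_iff)
  show ?thesis
    by (rule that[OF lim])
       (auto intro!: LIMSEQ_le_const[OF lim] LIMSEQ_le_const2[OF lim] simp: avoid_nonneg avoid_le_1)
qed

context rooted_tree
begin

text \<open>Clearing the denominator \<open>1 + k * l\<close> leaves an identity that passes
  directly to limits (recurrence) and to inequalities (transience).\<close>

lemma expectation_rw_step:
  assumes "locally_finite_tree T" "l > 0" "x \<in> tverts T" "x \<noteq> troot T"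
  shows "(1 + real (card (children T x)) * l) * measure_pmf.expectation (rw_step T l x) f =
    f (tparent T x) + l * (\<Sum>y\<in>children T x. f y)"
proof -
  let ?k = "real (card (children T x))"
  have pos: "1 + ?k * l > 0" using assms(2) by (simp add: add_pos_nonneg)
  have fin: "finite (children T x)"
    using assms by (simp add: locally_finite_tree_def)
  have par: "tparent T x \<notin> children T x"
    using parent_notin_children assms by blast
  note pmf = pmf_rw_step[OF assms]
  have "measure_pmf.expectation (rw_step T l x) f =
      (\<Sum>y\<in>insert (tparent T x) (children T x). f y * pmf (rw_step T l x) y)"
    using fin by (intro integral_measure_pmf_real) (auto simp: set_pmf_iff pmf split: if_splits)
  also have "\<dots> = f (tparent T x) * (1 / (1 + ?k * l)) + (\<Sum>y\<in>children T x. f y * (l / (1 + ?k * l)))"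
    using fin par by (auto simp: pmf intro!: sum.cong)
  also have "\<dots> = (f (tparent T x) + l * (\<Sum>y\<in>children T x. f y)) / (1 + ?k * l)"
    by (simp add: sum_distrib_left sum_divide_distrib add_divide_distrib mult.commute)
  finally show ?thesis using pos by simp
qed

lemma expectation_rw_step_root:
  assumes "locally_finite_tree T" "infinite_tree T"
  shows "real (card (children T (troot T))) * measure_pmf.expectation (rw_step T l (troot T)) f =
    (\<Sum>y\<in>children T (troot T). f y)"
    and "card (children T (troot T)) > 0"
proof -
  have fin: "finite (children T (troot T))"
    using assms root_in by (simp add: locally_finite_tree_def)
  then show "card (children T (troot T)) > 0"
    using children_root_nonempty[OF assms(2)] by (simp add: card_gt_0_iff)
  then show "real (card (children T (troot T))) * measure_pmf.expectation (rw_step T l (troot T)) f =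
    (\<Sum>y\<in>children T (troot T). f y)"
    using fin children_root_nonempty[OF assms(2)]
    by (simp add: rw_step_def integral_pmf_of_set)
qed

text \<open>The flow given by the gradient of the harmonic function \<open>h\<close> has the same
  strength \<open>D n\<close> at every level, and since \<open>h\<close> takes values in [0, 1] this
  strength is at most the total conductance of the level. The function \<open>d\<close> is the
  distance from the root.\<close>

lemma recurrent_if_conductance_tendsto_0:
  fixes d :: "'v \<Rightarrow> nat"
  assumes T: "locally_finite_tree T" "infinite_tree T" and l: "l > 0"
    and d: "\<And>x. x \<in> tverts T \<Longrightarrow> d x = 0 \<longleftrightarrow> x = troot T"
      "\<And>x y. x \<in> tverts T \<Longrightarrow> y \<in> children T x \<Longrightarrow> d y = Suc (d x)"
    and fin: "\<And>n. finite {x \<in> tverts T. d x = n}"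
    and lim: "(\<lambda>n. real (card {x \<in> tverts T. d x = n}) * l ^ n) \<longlonglongrightarrow> 0"
  shows "rw_recurrent T l"
proof -
  obtain g where g: "\<And>x. (\<lambda>n. avoid T l n x) \<longlonglongrightarrow> g x" "\<And>x. 0 \<le> g x" "\<And>x. g x \<le> 1"
    by (rule avoid_limit[of T l]) blast
  let ?o = "troot T"
  \<comment> \<open>At the root \<open>g\<close> is the escape probability, whereas the harmonic
    function has to vanish there.\<close>
  define h where "h x = (if x = ?o then 0 else g x)" for x
  define L where "L n = {x \<in> tverts T. d x = n}" for n
  \<comment> \<open>Net flow from level \<open>n\<close> to level \<open>n + 1\<close>, whose edges
    have conductance \<open>l ^ n\<close>.\<close>
  define D where "D n = (\<Sum>x\<in>L (Suc n). l ^ n * (h x - h (tparent T x)))" for n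
  have h01: "0 \<le> h x" "h x \<le> 1" for x
    using g by (auto simp: h_def)
  have hlim: "(\<lambda>n. if x = ?o then 0 else avoid T l n x) \<longlonglongrightarrow> h x" for x
    using g by (auto simp: h_def)
  \<comment> \<open>Limit of the one-step recursion, rewritten as Kirchhoff's node law: the inflow
    from the parent equals the outflow to the children.\<close>
  have harm: "h x - h (tparent T x) = l * (\<Sum>y\<in>children T x. h y - h x)"
    if x: "x \<in> tverts T" "x \<noteq> ?o" for x
  proof -
    let ?k = "real (card (children T x))"
    have "(\<lambda>n. (1 + ?k * l) * avoid T l (Suc n) x) \<longlonglongrightarrow> (1 + ?k * l) * g x"
      by (intro tendsto_intros LIMSEQ_Suc g)
    moreover have "(\<lambda>n. (1 + ?k * l) * avoid T l (Suc n) x) \<longlonglongrightarrow>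
        h (tparent T x) + l * (\<Sum>y\<in>children T x. h y)"
      unfolding avoid.simps expectation_rw_step[OF T(1) l x]
      by (intro tendsto_intros hlim)
    ultimately have "(1 + ?k * l) * g x = h (tparent T x) + l * (\<Sum>y\<in>children T x. h y)"
      by (rule LIMSEQ_unique)
    then show ?thesis
      using x by (simp add: h_def[of x] sum_subtractf algebra_simps)
  qed
  have root: "real (card (children T ?o)) * g ?o = (\<Sum>y\<in>children T ?o. h y)"
  proof -
    have "(\<lambda>n. real (card (children T ?o)) * avoid T l (Suc n) ?o) \<longlonglongrightarrow> real (card (children T ?o)) * g ?o"
      by (intro tendsto_intros LIMSEQ_Suc g)
    moreover have "(\<lambda>n. real (card (children T ?o)) * avoid T l (Suc n) ?o) \<longlonglongrightarrow> (\<Sum>y\<in>children T ?o. h y)"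
      unfolding avoid.simps expectation_rw_step_root(1)[OF T]
      by (intro tendsto_intros hlim)
    ultimately show ?thesis
      by (rule LIMSEQ_unique)
  qed
  have L_Suc: "L (Suc n) = (\<Union>x\<in>L n. children T x)" for n
  proof (intro equalityI subsetI)
    fix y assume y: "y \<in> L (Suc n)"
    then have "y \<noteq> ?o" "y \<in> tverts T"
      using d(1)[of y] by (auto simp: L_def)
    then have "tparent T y \<in> tverts T" "y \<in> children T (tparent T y)"
      using parent_in by (auto simp: children_def)
    then show "y \<in> (\<Union>x\<in>L n. children T x)"
      using y d(2)[of "tparent T y" y] by (auto simp: L_def)
  next
    fix y assume "y \<in> (\<Union>x\<in>L n. children T x)"
    then obtain x where "x \<in> L n" "y \<in> children T x" by blast
    then show "y \<in> L (Suc n)"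
      using d(2)[of x y] by (auto simp: L_def children_def)
  qed
  have finc: "finite (children T x)" if "x \<in> tverts T" for x
    using T(1) that by (simp add: locally_finite_tree_def)
  have sum_L: "(\<Sum>y\<in>L (Suc n). F y) = (\<Sum>x\<in>L n. \<Sum>y\<in>children T x. F y)" for n and F :: "'v \<Rightarrow> real"
    unfolding L_Suc using fin finc
    by (intro sum.UNION_disjoint) (auto simp: L_def children_def)
  have "D (Suc n) = D n" for n
  proof -
    have "D (Suc n) = (\<Sum>x\<in>L (Suc n). \<Sum>y\<in>children T x. l ^ Suc n * (h y - h x))"
      unfolding D_def sum_L[of _ "Suc n"] by (intro sum.cong refl) (auto simp: children_def)
    also have "\<dots> = (\<Sum>x\<in>L (Suc n). l ^ n * (l * (\<Sum>y\<in>children T x. h y - h x)))"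
      by (simp add: sum_distrib_left mult_ac)
    also have "\<dots> = D n"
      unfolding D_def
    proof (intro sum.cong refl)
      fix x assume "x \<in> L (Suc n)"
      then have "x \<in> tverts T" "x \<noteq> ?o"
        using d(1)[of x] by (auto simp: L_def)
      then show "l ^ n * (l * (\<Sum>y\<in>children T x. h y - h x)) = l ^ n * (h x - h (tparent T x))"
        by (simp add: harm)
    qed
    finally show ?thesis .
  qed
  then have const: "D n = D 0" for n
    by (induction n) auto
  have "L 0 = {?o}"
    using d(1) root_in by (auto simp: L_def)
  \<comment> \<open>The strength of the flow is the escape probability up to the number of children
    of the root, so it vanishes only in the recurrent case.\<close>
  then have D0: "D 0 = real (card (children T ?o)) * g ?o"
    unfolding D_def sum_L root by (auto simp: h_def children_def intro!: sum.cong)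
  \<comment> \<open>The edges into level \<open>n + 1\<close> have conductance \<open>l ^ n\<close>,
    while the hypothesis weights that level by \<open>l ^ Suc n\<close>; hence the division by
    \<open>l\<close>.\<close>
  have bound: "\<bar>D n\<bar> \<le> real (card (L (Suc n))) * l ^ Suc n / l" for n
  proof -
    have "\<bar>D n\<bar> \<le> (\<Sum>x\<in>L (Suc n). \<bar>l ^ n * (h x - h (tparent T x))\<bar>)"
      unfolding D_def by (rule sum_abs)
    also have "\<dots> \<le> (\<Sum>x\<in>L (Suc n). l ^ n * 1)"
    proof (intro sum_mono)
      fix x
      have "\<bar>h x - h (tparent T x)\<bar> \<le> 1"
        using h01[of x] h01[of "tparent T x"] by linarith
      then show "\<bar>l ^ n * (h x - h (tparent T x))\<bar> \<le> l ^ n * 1"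
        using l by (simp add: abs_mult)
    qed
    finally show ?thesis using l by simp
  qed
  have "(\<lambda>n. real (card (L n)) * l ^ n / l) \<longlonglongrightarrow> 0 / l"
    using lim unfolding L_def[symmetric] by (intro tendsto_divide tendsto_const) (use l in auto)
  then have lim': "(\<lambda>n. real (card (L (Suc n))) * l ^ Suc n / l) \<longlonglongrightarrow> 0"
    unfolding div_0 by (rule LIMSEQ_Suc)
  have "D \<longlonglongrightarrow> 0"
    by (rule Lim_null_comparison[OF _ lim']) (unfold real_norm_def, intro always_eventually allI bound)
  moreover have "D = (\<lambda>_. D 0)"
    using const by auto
  ultimately have "D 0 = 0"
    using LIMSEQ_const_iff[of "D 0" 0] by metis
  then have "g ?o = 0"
    using D0 expectation_rw_step_root(2)[OF T] by simp
  then show ?thesis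
    using g(1)[of ?o] by (simp add: rw_recurrent_iff_avoid)
qed

text \<open>Induction on \<open>n\<close> shows that \<open>f\<close> stays below \<open>K\<close>
  times the probability of avoiding the root up to time \<open>n\<close>. Positivity of
  \<open>f\<close> on some child of the root then keeps the probability of no return away from
  0.\<close>

lemma transient_if_bounded_subharmonic:
  assumes T: "locally_finite_tree T" "infinite_tree T" and l: "l > 0"
    and f: "\<And>x. x \<in> tverts T \<Longrightarrow> 0 \<le> f x" "\<And>x. x \<in> tverts T \<Longrightarrow> f x \<le> K" "f (troot T) = 0"
    and sub: "\<And>x. x \<in> tverts T \<Longrightarrow> x \<noteq> troot T \<Longrightarrow>
      f x - f (tparent T x) \<le> l * (\<Sum>y\<in>children T x. f y - f x)"
    and pos: "(\<Sum>y\<in>children T (troot T). f y) > 0"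
  shows "rw_transient T l"
proof -
  let ?o = "troot T"
  have ch: "y \<in> tverts T" "y \<noteq> ?o" if "y \<in> children T x" for x y
    using that by (auto simp: children_def)
  have "K \<ge> 0" using f(2)[OF root_in] f(3) by simp
  have le: "f x \<le> K * avoid T l n x" if "x \<in> tverts T" for n x
    using that
  proof (induction n arbitrary: x)
    case 0
    then show ?case using f by simp
  next
    case (Suc n)
    show ?case
    proof (cases "x = ?o")
      case True
      then show ?thesis
        using f(3) \<open>K \<ge> 0\<close> avoid_nonneg[of T l "Suc n" x] by (simp del: avoid.simps)
    next
      case False
      let ?k = "real (card (children T x))"
      let ?h = "\<lambda>y. if y = ?o then 0 else avoid T l n y"
      have fh: "f y \<le> K * ?h y" if "y \<in> tverts T" for y
        using Suc.IH[OF that] f(3) by auto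
      have kpos: "1 + ?k * l > 0" using l by (simp add: add_pos_nonneg)
      have "(1 + ?k * l) * f x \<le> f (tparent T x) + l * (\<Sum>y\<in>children T x. f y)"
        using sub[OF Suc.prems False] by (simp add: sum_subtractf algebra_simps)
      also have "\<dots> \<le> K * ?h (tparent T x) + l * (\<Sum>y\<in>children T x. K * ?h y)"
        using l parent_in[OF Suc.prems False]
        by (intro add_mono fh mult_left_mono sum_mono) (auto dest: ch)
      also have "\<dots> = K * (?h (tparent T x) + l * (\<Sum>y\<in>children T x. ?h y))"
        by (simp add: sum_distrib_left algebra_simps)
      also have "\<dots> = (1 + ?k * l) * (K * avoid T l (Suc n) x)"
        unfolding avoid.simps expectation_rw_step[OF T(1) l Suc.prems False, of ?h, symmetric]
        by simp
      finally show ?thesis using kpos by simp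
    qed
  qed
  \<comment> \<open>At the root itself \<open>f\<close> vanishes and the comparison is empty, so it
    is used at the children, one step later.\<close>
  let ?k = "real (card (children T ?o))"
  have "(\<Sum>y\<in>children T ?o. f y) \<le> K * ?k * avoid T l (Suc n) ?o" for n
  proof -
    have "(\<Sum>y\<in>children T ?o. f y) \<le> (\<Sum>y\<in>children T ?o. K * (if y = ?o then 0 else avoid T l n y))"
      by (intro sum_mono) (use ch le in auto)
    also have "\<dots> = K * ?k * avoid T l (Suc n) ?o"
      unfolding avoid.simps mult.assoc expectation_rw_step_root(1)[OF T] sum_distrib_left ..
    finally show ?thesis .
  qed
  then have "(\<Sum>y\<in>children T ?o. f y) \<le> 0"
    if "(\<lambda>n. avoid T l n ?o) \<longlonglongrightarrow> 0"
  proof -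
    have "(\<lambda>n. K * ?k * avoid T l (Suc n) ?o) \<longlonglongrightarrow> K * ?k * 0"
      by (intro tendsto_intros LIMSEQ_Suc that)
    then show ?thesis
      using \<open>\<And>n. (\<Sum>y\<in>children T ?o. f y) \<le> K * ?k * avoid T l (Suc n) ?o\<close>
      by (intro LIMSEQ_le_const) auto
  qed
  then show ?thesis
    using pos unfolding rw_transient_def rw_recurrent_iff_avoid by force
qed

end

section \<open>Self-avoiding walks as step sequences\<close>

definition steps :: "(int \<times> int) set" where
  "steps = {(1, 0), (-1, 0), (0, 1), (0, -1)}"

text \<open>A walk repeats a vertex exactly when the steps in between, a nonempty factor, sum to zero.\<close>

definition self_avoiding :: "(int \<times> int) list \<Rightarrow> bool" where
  "self_avoiding s \<longleftrightarrow> (\<forall>a b c. s = a @ b @ c \<longrightarrow> b \<noteq> [] \<longrightarrow> sum_list b \<noteq> 0)"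

abbreviation xsum :: "(int \<times> int) list \<Rightarrow> int" where
  "xsum s \<equiv> sum_list (map fst s)"

abbreviation ysum :: "(int \<times> int) list \<Rightarrow> int" where
  "ysum s \<equiv> sum_list (map snd s)"

lemma sum_list_prod_eq: "sum_list s = (xsum s, ysum s)"
  by (induction s) (auto simp: zero_prod_def)

lemma self_avoiding_Nil [simp]: "self_avoiding []"
  by (simp add: self_avoiding_def)

lemma self_avoiding_factor: "self_avoiding (a @ b @ c) \<Longrightarrow> self_avoiding b"
  unfolding self_avoiding_def by (metis append.assoc)

lemma self_avoiding_prefix: "self_avoiding (a @ b) \<Longrightarrow> self_avoiding a"
  using self_avoiding_factor[of "[]" a b] by simp

lemma self_avoiding_suffix: "self_avoiding (a @ b) \<Longrightarrow> self_avoiding b"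
  using self_avoiding_factor[of a b "[]"] by simp

text \<open>A factor of \<open>u @ v\<close> lies in \<open>u\<close>, lies in \<open>v\<close>, or
  straddles the junction; the third hypothesis handles the last kind.\<close>

lemma self_avoiding_appendI:
  assumes "self_avoiding u" "self_avoiding v"
    and "\<And>a b c d. u = a @ b \<Longrightarrow> v = c @ d \<Longrightarrow> b \<noteq> [] \<Longrightarrow> c \<noteq> [] \<Longrightarrow> sum_list b + sum_list c \<noteq> 0"
  shows "self_avoiding (u @ v)"
  unfolding self_avoiding_def
proof (intro allI impI)
  fix a b c assume *: "u @ v = a @ b @ c" "b \<noteq> []"
  then consider d where "u = a @ d" "d @ v = b @ c" | d where "u @ d = a" "v = d @ b @ c"
    by (auto simp: append_eq_append_conv2)
  then show "sum_list b \<noteq> 0"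
  proof cases
    case 1
    from 1(2) consider e where "d = b @ e" "c = e @ v" | e where "b = d @ e" "v = e @ c"
      by (auto simp: append_eq_append_conv2)
    then show ?thesis
    proof cases
      case 1
      then show ?thesis using \<open>u = a @ d\<close> * assms(1) unfolding self_avoiding_def by blast
    next
      case 2
      show ?thesis
      proof (cases "d = [] \<or> e = []")
        case True
        then show ?thesis
          using 2 \<open>u = a @ d\<close> * assms(1,2) unfolding self_avoiding_def
          by (metis append_Nil append_Nil2)
      next
        case False
        then show ?thesis
          using 2 \<open>u = a @ d\<close> assms(3)[of a d e c] by simp
      qed
    qed
  next
    case 2
    then show ?thesis using * assms(2) unfolding self_avoiding_def by blast
  qed
qed

text \<open>Factors are reversed but keep their sums. Geometrically, reversing the step list
  traverses the walk backwards and turns it by 180 degrees.\<close>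

lemma self_avoiding_rev: "self_avoiding s \<Longrightarrow> self_avoiding (rev s)"
  unfolding self_avoiding_def
  by (metis append.assoc rev_append rev_is_Nil_conv rev_swap sum_list_rev)

section \<open>Reflections in the coordinate axes\<close>

definition flip_x :: "int \<times> int \<Rightarrow> int \<times> int" where
  "flip_x v = (- fst v, snd v)"

definition flip_y :: "int \<times> int \<Rightarrow> int \<times> int" where
  "flip_y v = (fst v, - snd v)"

lemma flip_simps [simp]:
  "flip_x (flip_x v) = v" "flip_y (flip_y v) = v"
  "fst (flip_x v) = - fst v" "snd (flip_x v) = snd v"
  "fst (flip_y v) = fst v" "snd (flip_y v) = - snd v"
  "flip_x \<circ> flip_x = id" "flip_y \<circ> flip_y = id"
  by (auto simp: flip_x_def flip_y_def fun_eq_iff)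

lemma flip_in_steps: "set s \<subseteq> steps \<Longrightarrow> set (map flip_x s) \<subseteq> steps"
  "set s \<subseteq> steps \<Longrightarrow> set (map flip_y s) \<subseteq> steps"
  by (auto simp: steps_def flip_x_def flip_y_def)

lemma sum_list_flip [simp]:
  "sum_list (map (fst \<circ> flip_x) s) = - xsum s"
  "sum_list (map (snd \<circ> flip_x) s) = ysum s"
  "sum_list (map (fst \<circ> flip_y) s) = xsum s"
  "sum_list (map (snd \<circ> flip_y) s) = - ysum s"
  by (induction s) auto

lemma self_avoiding_flip:
  assumes s: "self_avoiding s"
  shows "self_avoiding (map flip_x s)" "self_avoiding (map flip_y s)"
proof -
  have *: "self_avoiding (map f s)"
    if f: "f \<circ> f = id" "\<And>b. sum_list b = 0 \<Longrightarrow> sum_list (map f b) = 0" for f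
    unfolding self_avoiding_def
  proof (intro allI impI)
    fix a b c assume "map f s = a @ b @ c" "b \<noteq> []"
    then have "s = map f a @ map f b @ map f c"
      using f(1) by (metis list.map_comp list.map_id map_append)
    then have "sum_list (map f b) \<noteq> 0"
      using s \<open>b \<noteq> []\<close> unfolding self_avoiding_def by blast
    then show "sum_list b \<noteq> 0"
      using f(2) by blast
  qed
  show "self_avoiding (map flip_x s)" "self_avoiding (map flip_y s)"
    by (rule *; simp add: sum_list_prod_eq zero_prod_def)+
qed

section \<open>Half-space walks and bridges in the x direction\<close>

definition half_space :: "(int \<times> int) list \<Rightarrow> bool" where
  "half_space s \<longleftrightarrow> (\<forall>a b. s = a @ b \<longrightarrow> a \<noteq> [] \<longrightarrow> xsum a > 0)"

text \<open>The suffix condition makes the x coordinate maximal at the last vertex, which turns a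
  half-space walk into a bridge in the sense of Hammersley and Welsh.\<close>

definition bridge :: "(int \<times> int) list \<Rightarrow> bool" where
  "bridge s \<longleftrightarrow> half_space s \<and> (\<forall>a b. s = a @ b \<longrightarrow> xsum b \<ge> 0)"

text \<open>Induction on the list. Prepending a letter leaves the cut in place unless the old
  maximum falls strictly below the new starting value 0; then the cut moves to the very
  beginning.\<close>

lemma split_at_last_max:
  fixes \<phi> :: "'a \<Rightarrow> int"
  obtains u v where "s = u @ v"
    "\<And>a b. u = a @ b \<Longrightarrow> sum_list (map \<phi> b) \<ge> 0"
    "\<And>a b. v = a @ b \<Longrightarrow> a \<noteq> [] \<Longrightarrow> sum_list (map \<phi> a) < 0"
proof -
  have "\<exists>u v. s = u @ v \<and> (\<forall>a b. u = a @ b \<longrightarrow> sum_list (map \<phi> b) \<ge> 0) \<and>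
    (\<forall>a b. v = a @ b \<longrightarrow> a \<noteq> [] \<longrightarrow> sum_list (map \<phi> a) < 0)"
  proof (induction s)
    case (Cons x s)
    then obtain u v where uv: "s = u @ v" "\<forall>a b. u = a @ b \<longrightarrow> sum_list (map \<phi> b) \<ge> 0"
      "\<forall>a b. v = a @ b \<longrightarrow> a \<noteq> [] \<longrightarrow> sum_list (map \<phi> a) < 0" by blast
    show ?case
    proof (cases "\<phi> x + sum_list (map \<phi> u) \<ge> 0")
      case True
      then have "\<forall>a b. x # u = a @ b \<longrightarrow> sum_list (map \<phi> b) \<ge> 0"
        using uv(2) by (auto simp: Cons_eq_append_conv)
      then show ?thesis
        using uv by (intro exI[of _ "x # u"] exI[of _ v]) simp
    next
      case False
      have "sum_list (map \<phi> a) < 0" if ab: "x # s = a @ b" "a \<noteq> []" for a b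
      proof -
        obtain a' where a': "a = x # a'" "s = a' @ b"
          using ab by (cases a) auto
        then have "u @ v = a' @ b" using uv by simp
        then consider e where "u = a' @ e" | e where "a' = u @ e" "v = e @ b"
          by (auto simp: append_eq_append_conv2)
        then show ?thesis
        proof cases
          case 1
          then have "sum_list (map \<phi> e) \<ge> 0" using uv by blast
          then show ?thesis using 1 False a' by simp
        next
          case 2
          then have "sum_list (map \<phi> e) \<le> 0" using uv(3) by (cases "e = []") force+
          then show ?thesis using 2 False a' by simp
        qed
      qed
      then show ?thesis
        by (intro exI[of _ "[]"] exI[of _ "x # s"]) simp
    qed
  qed simp
  then show ?thesis using that by blast
qed

section \<open>The Hammersley--Welsh bound\<close>

definition sa_walks :: "nat \<Rightarrow> (int \<times> int) list set" where
  "sa_walks n = {s. set s \<subseteq> steps \<and> length s = n \<and> self_avoiding s}"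

definition bridges :: "nat \<Rightarrow> (int \<times> int) list set" where
  "bridges n = {s \<in> sa_walks n. bridge s}"

text \<open>The length is only bounded, by \<open>N\<close>: this keeps the set finite, so that
  generating functions are finite sums to be bounded uniformly in \<open>N\<close>.\<close>

definition span_bridges :: "nat \<Rightarrow> nat \<Rightarrow> (int \<times> int) list set" where
  "span_bridges N A = {s. set s \<subseteq> steps \<and> length s \<le> N \<and> self_avoiding s \<and> bridge s \<and> xsum s = int A}"

definition half_space_walks :: "nat \<Rightarrow> nat \<Rightarrow> (int \<times> int) list set" where
  "half_space_walks N A = {s. set s \<subseteq> steps \<and> length s \<le> N \<and> self_avoiding s \<and> half_space s \<and>
     (\<forall>a b. s = a @ b \<longrightarrow> xsum a \<le> int A)}"

lemma finite_steps [simp]: "finite steps"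
  by (simp add: steps_def)

lemma finite_sa_walks [simp]: "finite (sa_walks n)"
  by (rule finite_subset[OF _ finite_lists_length_eq[OF finite_steps, of n]])
     (auto simp: sa_walks_def)

lemma finite_bridges [simp]: "finite (bridges n)"
  by (simp add: bridges_def)

lemma finite_span_bridges [simp]: "finite (span_bridges N A)"
  by (rule finite_subset[OF _ finite_lists_length_le[OF finite_steps, of N]])
     (auto simp: span_bridges_def)

lemma finite_half_space_walks [simp]: "finite (half_space_walks N A)"
  by (rule finite_subset[OF _ finite_lists_length_le[OF finite_steps, of N]])
     (auto simp: half_space_walks_def)

text \<open>One unfolding step of Hammersley and Welsh: up to the last visit to the maximal x
  coordinate \<open>a\<close> the walk is a bridge, and the remainder, reflected, is a half-space
  walk again. The remainder stays at positive x, so its width is strictly smaller than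
  \<open>a\<close>.\<close>

lemma half_space_walk_unfold:
  assumes s: "s \<in> half_space_walks N A" "s \<noteq> []"
  obtains a u v where "a \<in> {1..A}" "u \<in> span_bridges N a" "v \<in> half_space_walks N (a - 1)"
    "s = u @ map flip_x v"
proof -
  have st: "set s \<subseteq> steps" "length s \<le> N" "self_avoiding s"
    and hs: "\<And>a b. s = a @ b \<Longrightarrow> a \<noteq> [] \<Longrightarrow> xsum a > 0"
    and le: "\<And>a b. s = a @ b \<Longrightarrow> xsum a \<le> int A"
    using s by (auto simp: half_space_walks_def half_space_def)
  obtain u v where uv: "s = u @ v"
    "\<And>a b. u = a @ b \<Longrightarrow> xsum b \<ge> 0"
    "\<And>a b. v = a @ b \<Longrightarrow> a \<noteq> [] \<Longrightarrow> xsum a < 0"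
    by (rule split_at_last_max[of s fst]) blast
  have "u \<noteq> []"
  proof
    assume "u = []"
    then have "xsum s < 0" using uv s(2) by simp
    moreover have "xsum s > 0" using hs[of s "[]"] s(2) by simp
    ultimately show False by simp
  qed
  then have pos: "xsum u > 0" using hs uv(1) by blast
  have u: "u \<in> span_bridges N (nat (xsum u))"
    using st uv pos hs by (auto simp: span_bridges_def bridge_def half_space_def dest: self_avoiding_prefix)
  have v: "map flip_x v \<in> half_space_walks N (nat (xsum u) - 1)"
  proof -
    have "half_space (map flip_x v)"
      unfolding half_space_def by (auto simp: map_eq_append_conv dest!: uv(3))
    moreover have "xsum a \<le> int (nat (xsum u) - 1)" if ab: "map flip_x v = a @ b" for a b
    proof -
      obtain a' b' where "v = a' @ b'" "a = map flip_x a'"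
        using ab by (auto simp: map_eq_append_conv)
      \<comment> \<open>Strict positivity of the original walk gives the decrease from
        \<open>a\<close> to \<open>a - 1\<close>.\<close>
      moreover from this have "xsum (u @ a') > 0"
        using hs[of "u @ a'" b'] uv(1) \<open>u \<noteq> []\<close> by simp
      ultimately show ?thesis using pos by auto
    qed
    moreover have "set (map flip_x v) \<subseteq> steps" "self_avoiding (map flip_x v)" "length v \<le> N"
      using st uv(1) flip_in_steps(1)[of v] self_avoiding_flip(1)[OF self_avoiding_suffix[of u v]]
      by auto
    ultimately show ?thesis
      unfolding half_space_walks_def by auto
  qed
  show ?thesis
    using that[of "nat (xsum u)", OF _ u v] le[OF uv(1)] pos uv(1) by (simp add: nat_le_iff Suc_le_eq)
qed

section \<open>Generating functions of sets of walks, by length\<close>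

definition weight :: "real \<Rightarrow> 'a list set \<Rightarrow> real" where
  "weight z S = (\<Sum>s\<in>S. z ^ length s)"

text \<open>Lengths add, so weights multiply over pairs; collisions under \<open>f\<close> can only
  lower the left-hand side.\<close>

lemma weight_image_mult_le:
  assumes "finite S" "finite S'" "z \<ge> 0" "\<And>u v. u \<in> S \<Longrightarrow> v \<in> S' \<Longrightarrow> length (f u v) = length u + length v"
  shows "weight z ((\<lambda>(u, v). f u v) ` (S \<times> S')) \<le> weight z S * weight z S'"
proof -
  have "weight z ((\<lambda>(u, v). f u v) ` (S \<times> S')) \<le> (\<Sum>(u, v)\<in>S \<times> S'. z ^ length (f u v))"
    unfolding weight_def using assms
    by (intro order.trans[OF sum_image_le]) (auto simp: case_prod_unfold)
  also have "\<dots> = (\<Sum>(u, v)\<in>S \<times> S'. z ^ length u * z ^ length v)"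
    using assms(4) by (intro sum.cong) (auto simp: power_add)
  also have "\<dots> = weight z S * weight z S'"
    unfolding weight_def by (simp add: sum_product sum.cartesian_product)
  finally show ?thesis .
qed

lemma weight_mono: "S \<subseteq> S' \<Longrightarrow> finite S' \<Longrightarrow> z \<ge> 0 \<Longrightarrow> weight z S \<le> weight z S'"
  unfolding weight_def by (intro sum_mono2) auto

lemma weight_nonneg: "z \<ge> 0 \<Longrightarrow> weight z S \<ge> 0"
  unfolding weight_def by (intro sum_nonneg) auto

lemma weight_UN_le:
  assumes "finite I" "\<And>i. i \<in> I \<Longrightarrow> finite (S i)" "z \<ge> 0"
  shows "weight z (\<Union>i\<in>I. S i) \<le> (\<Sum>i\<in>I. weight z (S i))"
  using assms
proof (induction I rule: finite_induct)
  case (insert i I)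
  have "weight z (S i \<union> (\<Union>i\<in>I. S i)) + weight z (S i \<inter> (\<Union>i\<in>I. S i)) =
      weight z (S i) + weight z (\<Union>i\<in>I. S i)"
    unfolding weight_def using insert.hyps insert.prems by (intro sum.union_inter) auto
  moreover have "weight z (\<Union>i\<in>I. S i) \<le> (\<Sum>i\<in>I. weight z (S i))"
    using insert.prems by (intro insert.IH) auto
  ultimately show ?case
    using insert.hyps weight_nonneg[OF insert.prems(2), of "S i \<inter> (\<Union>i\<in>I. S i)"] by simp
qed (simp add: weight_def)

lemma weight_half_space_walks_rec:
  assumes "z \<ge> 0"
  shows "weight z (half_space_walks N A) \<le>
    1 + (\<Sum>a\<in>{1..A}. weight z (span_bridges N a) * weight z (half_space_walks N (a - 1)))"
proof -
  let ?S = "\<lambda>a. (\<lambda>(u, v). u @ map flip_x v) ` (span_bridges N a \<times> half_space_walks N (a - 1))"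
  have "half_space_walks N A - {[]} \<subseteq> (\<Union>a\<in>{1..A}. ?S a)"
  proof
    fix s assume "s \<in> half_space_walks N A - {[]}"
    then obtain a u v where "a \<in> {1..A}" "u \<in> span_bridges N a" "v \<in> half_space_walks N (a - 1)"
      "s = u @ map flip_x v"
      using half_space_walk_unfold[of s N A] by blast
    then show "s \<in> (\<Union>a\<in>{1..A}. ?S a)"
      by (intro UN_I image_eqI[of _ _ "(u, v)"]) auto
  qed
  then have "weight z (half_space_walks N A - {[]}) \<le> weight z (\<Union>a\<in>{1..A}. ?S a)"
    using assms by (intro weight_mono) auto
  also have "\<dots> \<le> (\<Sum>a\<in>{1..A}. weight z (?S a))"
    using assms by (intro weight_UN_le) auto
  also have "\<dots> \<le> (\<Sum>a\<in>{1..A}. weight z (span_bridges N a) * weight z (half_space_walks N (a - 1)))"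
    using assms by (intro sum_mono weight_image_mult_le) auto
  finally have "weight z (half_space_walks N A - {[]}) \<le> \<dots>" .
  moreover have "weight z (half_space_walks N A) \<le> 1 + weight z (half_space_walks N A - {[]})"
    by (cases "[] \<in> half_space_walks N A") (auto simp: weight_def sum.remove)
  ultimately show ?thesis by simp
qed

text \<open>Iterated unfolding produces bridges of strictly decreasing spans. Each span is used at
  most once, which a product of factors 1 + (weight of that span) accounts for.\<close>

lemma weight_half_space_walks_le_prod:
  assumes "z \<ge> 0"
  shows "weight z (half_space_walks N A) \<le> (\<Prod>a\<in>{1..A}. 1 + weight z (span_bridges N a))"
proof (induction A rule: less_induct)
  case (less A)
  let ?b = "\<lambda>a. weight z (span_bridges N a)"
  have "weight z (half_space_walks N A) \<le> 1 + (\<Sum>a\<in>{1..A}. ?b a * weight z (half_space_walks N (a - 1)))"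
    by (rule weight_half_space_walks_rec) fact
  also have "\<dots> \<le> 1 + (\<Sum>a\<in>{1..A}. ?b a * (\<Prod>i\<in>{1..a - 1}. 1 + ?b i))"
    using assms by (intro add_left_mono sum_mono mult_left_mono less weight_nonneg) auto
  \<comment> \<open>Expanding the product according to the largest span \<open>a\<close> that is
    used.\<close>
  also have "\<dots> = (\<Prod>a\<in>{1..A}. 1 + ?b a)"
    by (induction A) (auto simp: algebra_simps)
  finally show ?case .
qed

text \<open>Different spans give disjoint sets of bridges, and a positive span excludes the empty
  bridge, so the right-hand sum starts at length 1.\<close>

lemma sum_weight_span_bridges_le:
  assumes "z \<ge> 0"
  shows "(\<Sum>a\<in>{1..A}. weight z (span_bridges N a)) \<le> (\<Sum>n\<in>{1..N}. real (card (bridges n)) * z ^ n)"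
proof -
  have "(\<Sum>a\<in>{1..A}. weight z (span_bridges N a)) = weight z (\<Union>a\<in>{1..A}. span_bridges N a)"
    unfolding weight_def by (intro sum.UNION_disjoint[symmetric] ballI impI finite_span_bridges) (auto simp: span_bridges_def)
  also have "\<dots> \<le> weight z (\<Union>n\<in>{1..N}. bridges n)"
  proof (intro weight_mono)
    show "(\<Union>a\<in>{1..A}. span_bridges N a) \<subseteq> (\<Union>n\<in>{1..N}. bridges n)"
      by (auto simp: span_bridges_def bridges_def sa_walks_def Suc_le_eq)
  qed (use assms in auto)
  also have "\<dots> = (\<Sum>n\<in>{1..N}. weight z (bridges n))"
    unfolding weight_def by (intro sum.UNION_disjoint ballI impI finite_bridges) (auto simp: bridges_def sa_walks_def)
  also have "\<dots> = (\<Sum>n\<in>{1..N}. real (card (bridges n)) * z ^ n)"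
    unfolding weight_def by (intro sum.cong refl) (simp add: bridges_def sa_walks_def)
  finally show ?thesis .
qed

text \<open>From \<open>1 + t \<le> exp t\<close> in each factor; the bound no longer depends on the
  width \<open>A\<close>.\<close>

lemma weight_half_space_walks_le_exp:
  assumes "z \<ge> 0"
  shows "weight z (half_space_walks N A) \<le> exp (\<Sum>n\<in>{1..N}. real (card (bridges n)) * z ^ n)"
proof -
  have "weight z (half_space_walks N A) \<le> (\<Prod>a\<in>{1..A}. 1 + weight z (span_bridges N a))"
    by (rule weight_half_space_walks_le_prod) fact
  also have "\<dots> \<le> (\<Prod>a\<in>{1..A}. exp (weight z (span_bridges N a)))"
    using assms by (intro prod_mono conjI add_nonneg_nonneg weight_nonneg) auto
  also have "\<dots> = exp (\<Sum>a\<in>{1..A}. weight z (span_bridges N a))"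
    by (simp add: exp_sum)
  also have "\<dots> \<le> exp (\<Sum>n\<in>{1..N}. real (card (bridges n)) * z ^ n)"
    using sum_weight_span_bridges_le[OF assms] by simp
  finally show ?thesis .
qed

lemma xsum_le_length: "set s \<subseteq> steps \<Longrightarrow> xsum s \<le> int (length s)"
  by (induction s) (auto simp: steps_def)

lemma half_space_walksI:
  assumes "set s \<subseteq> steps" "length s \<le> N" "self_avoiding s" "half_space s"
  shows "s \<in> half_space_walks N N"
proof -
  have "xsum a \<le> int N" if "s = a @ b" for a b
    using xsum_le_length[of a] that assms(1,2) by simp
  then show ?thesis using assms by (auto simp: half_space_walks_def)
qed

text \<open>Cut the walk at its last minimum of x. The second piece is a half-space walk. The first
  piece, reversed and reflected, stays at x >= 0; an extra step to the right in front makes it a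
  half-space walk, at the price of a factor \<open>1 / z\<close>.\<close>

lemma card_sa_walks_le:
  assumes "z > 0"
  shows "real (card (sa_walks N)) * z ^ N \<le> (weight z (half_space_walks (Suc N) (Suc N)))\<^sup>2 / z"
proof -
  let ?H = "half_space_walks (Suc N) (Suc N)"
  \<comment> \<open>The admissible first pieces, described by their extension with the extra
    step.\<close>
  let ?Q = "{q. (1, 0) # q \<in> ?H}"
  have img: "(#) (1, 0) ` ?Q \<subseteq> ?H" by auto
  then have finQ: "finite ?Q"
    using finite_imageD[OF finite_subset[OF img]] by (auto simp: inj_on_def)
  have "sa_walks N \<subseteq> (\<lambda>(q, v). rev (map flip_x q) @ v) ` (?Q \<times> ?H)"
  proof
    fix s assume s: "s \<in> sa_walks N"
    obtain u v where uv: "s = u @ v"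
      "\<And>a b. u = a @ b \<Longrightarrow> sum_list (map (\<lambda>x. - fst x) b) \<ge> 0"
      "\<And>a b. v = a @ b \<Longrightarrow> a \<noteq> [] \<Longrightarrow> sum_list (map (\<lambda>x. - fst x) a) < 0"
      by (rule split_at_last_max[of s "\<lambda>x. - fst x"]) blast
    have neg: "sum_list (map (\<lambda>x. - fst x) a) = - xsum a" for a :: "(int \<times> int) list"
      by (induction a) auto
    have v: "v \<in> ?H"
      using s uv by (intro half_space_walksI) (auto simp: sa_walks_def half_space_def neg dest: self_avoiding_suffix)
    let ?q = "rev (map flip_x u)"
    \<comment> \<open>Only a weak inequality: the first piece may visit its minimal column several
      times.\<close>
    have pre: "xsum a \<ge> 0" if "?q = a @ b" for a b
    proof -
      have "map flip_x u = rev b @ rev a"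
        using that by (metis rev_append rev_rev_ident)
      then obtain b' a' where "u = b' @ a'" "rev a = map flip_x a'"
        by (auto simp: map_eq_append_conv)
      moreover from this have "xsum (rev a) = - xsum a'" by simp
      moreover have "xsum a = xsum (rev a)"
        by (metis rev_map sum_list_rev)
      ultimately show ?thesis
        using uv(2)[of b' a'] by (simp add: neg)
    qed
    have "(1, 0) # ?q \<in> ?H"
    proof (rule half_space_walksI)
      show "set ((1, 0) # ?q) \<subseteq> steps" "length ((1, 0) # ?q) \<le> Suc N"
        using s uv(1) by (auto simp: sa_walks_def steps_def flip_x_def)
      have "self_avoiding ([(1, 0)] @ ?q)"
      proof (rule self_avoiding_appendI)
        show "self_avoiding [(1, 0)]"
          by (auto simp: self_avoiding_def zero_prod_def Cons_eq_append_conv)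
        show "self_avoiding ?q"
          using s uv(1) self_avoiding_prefix[of u v]
          by (intro self_avoiding_rev self_avoiding_flip) (simp add: sa_walks_def)
        fix a b c d :: "(int \<times> int) list" assume "[(1, 0)] = a @ b" "?q = c @ d" "b \<noteq> []"
        then have "b = [(1, 0)]" "xsum c \<ge> 0" using pre by (auto simp: Cons_eq_append_conv)
        then show "sum_list b + sum_list c \<noteq> 0"
          by (auto simp: sum_list_prod_eq zero_prod_def)
      qed
      then show "self_avoiding ((1, 0) # ?q)" by simp
      show "half_space ((1, 0) # ?q)"
        unfolding half_space_def by (auto simp: Cons_eq_append_conv dest!: pre)
    qed
    then show "s \<in> (\<lambda>(q, v). rev (map flip_x q) @ v) ` (?Q \<times> ?H)"
      using v uv(1) by (intro image_eqI[of _ _ "(?q, v)"]) (auto simp: rev_map)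
  qed
  then have "weight z (sa_walks N) \<le> weight z ((\<lambda>(q, v). rev (map flip_x q) @ v) ` (?Q \<times> ?H))"
    using assms finQ by (intro weight_mono) auto
  also have "\<dots> \<le> weight z ?Q * weight z ?H"
    using assms finQ by (intro weight_image_mult_le) auto
  also have "\<dots> \<le> (weight z ?H / z) * weight z ?H"
  proof (intro mult_right_mono weight_nonneg)
    have "z * weight z ?Q = weight z ((#) (1, 0) ` ?Q)"
      unfolding weight_def by (subst sum.reindex) (auto simp: sum_distrib_left)
    also have "\<dots> \<le> weight z ?H"
      using assms img by (intro weight_mono) auto
    finally show "weight z ?Q \<le> weight z ?H / z"
      using assms by (simp add: field_simps)
  qed (use assms in auto)
  finally have "weight z (sa_walks N) \<le> (weight z ?H)\<^sup>2 / z"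
    by (simp add: power2_eq_square)
  moreover have "weight z (sa_walks N) = real (card (sa_walks N)) * z ^ N"
    unfolding weight_def by (simp add: sa_walks_def)
  ultimately show ?thesis by simp
qed

text \<open>If all these products were at most 2, the bridge generating function would be bounded at
  some \<open>z\<close> with \<open>1 / \<mu> < z < l\<close>. Then so would be the one of
  half-space walks, and hence the weights of all walks of length \<open>N\<close>, which are at
  least \<open>(\<mu> * z) ^ N\<close>. The value 2 leaves more than 1 after halving the bridges
  into blocks.\<close>

lemma many_bridges:
  assumes \<mu>: "\<And>n. n \<ge> 1 \<Longrightarrow> real (card (sa_walks n)) \<ge> \<mu> ^ n" and l: "l > 0" "l * \<mu> > 1"
  obtains n where "n \<ge> 1" "real (card (bridges n)) * l ^ n > 2"
proof (rule ccontr)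
  assume "\<not> thesis"
  with that have le: "real (card (bridges n)) * l ^ n \<le> 2" if "n \<ge> 1" for n
    using \<open>n \<ge> 1\<close> by (meson not_le)
  have "\<mu> > 0" using l zero_less_mult_pos[of l \<mu>] by simp
  then have "1 / \<mu> < l" using l by (simp add: field_simps)
  then obtain z where z: "1 / \<mu> < z" "z < l" using dense by blast
  have z0: "z > 0" using z \<open>\<mu> > 0\<close> by (meson less_trans zero_less_divide_1_iff)
  have z\<mu>: "z * \<mu> > 1" using z \<open>\<mu> > 0\<close> by (simp add: field_simps)
  define q where "q = z / l"
  have q: "0 < q" "q < 1" using z z0 l by (auto simp: q_def)
  \<comment> \<open>Exponential of a bound for the geometric series with terms
    \<open>2 * q ^ n\<close>.\<close>
  define K where "K = exp (2 * (1 / (1 - q)))"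
  have H: "weight z (half_space_walks N N) \<le> K" for N
  proof -
    have "(\<Sum>n\<in>{1..N}. real (card (bridges n)) * z ^ n) \<le> (\<Sum>n\<in>{1..N}. 2 * q ^ n)"
    proof (intro sum_mono)
      fix n assume "n \<in> {1..N}"
      then have "real (card (bridges n)) * l ^ n * q ^ n \<le> 2 * q ^ n"
        using q le[of n] by (intro mult_right_mono) auto
      then show "real (card (bridges n)) * z ^ n \<le> 2 * q ^ n"
        using l by (simp add: q_def power_divide)
    qed
    also have "\<dots> \<le> 2 * (\<Sum>n<Suc N. q ^ n)"
      unfolding sum_distrib_left[symmetric] using q by (intro mult_left_mono sum_mono2) auto
    also have "\<dots> \<le> 2 * (1 / (1 - q))"
    proof -
      have "(\<Sum>n<Suc N. q ^ n) \<le> (\<Sum>n. q ^ n)"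
        using q by (intro sum_le_suminf summable_geometric) auto
      then show ?thesis using q by (simp add: suminf_geometric)
    qed
    finally show ?thesis
      unfolding K_def using weight_half_space_walks_le_exp[of z N N] z0
      by (meson exp_le_cancel_iff less_imp_le order.trans)
  qed
  have bound: "(\<mu> * z) ^ N \<le> K\<^sup>2 / z" if "N \<ge> 1" for N
  proof -
    have "(\<mu> * z) ^ N \<le> real (card (sa_walks N)) * z ^ N"
      unfolding power_mult_distrib using \<mu>[OF that] z0 by (intro mult_right_mono) auto
    also have "\<dots> \<le> (weight z (half_space_walks (Suc N) (Suc N)))\<^sup>2 / z"
      by (rule card_sa_walks_le) fact
    also have "\<dots> \<le> K\<^sup>2 / z"
      using z0 H weight_nonneg[of z] by (intro divide_right_mono power_mono) auto
    finally show ?thesis .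
  qed
  obtain N where N: "K\<^sup>2 / z < (\<mu> * z) ^ N"
    using real_arch_pow z\<mu> by (metis mult.commute)
  then have "K\<^sup>2 / z < (\<mu> * z) ^ Suc N"
    using z\<mu> by (smt (verit, best) mult.commute power_Suc power_strict_increasing lessI)
  with bound[of "Suc N"] show False by simp
qed

section \<open>Blocks\<close>

text \<open>Ending no lower than the start prevents a concatenation of blocks from drifting
  downwards.\<close>

definition blocks :: "nat \<Rightarrow> (int \<times> int) list set" where
  "blocks n = {s \<in> bridges n. ysum s \<ge> 0}"

lemma finite_blocks [simp]: "finite (blocks n)"
  by (simp add: blocks_def)

text \<open>The reflection \<open>flip_y\<close> preserves bridges and changes the sign of the final
  height.\<close>

lemma card_bridges_le_blocks: "card (bridges n) \<le> 2 * card (blocks n)"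
proof -
  have "bridge (map flip_y s)" if s: "bridge s" for s
  proof -
    have "xsum a > 0" if "map flip_y s = a @ b" "a \<noteq> []" for a b
    proof -
      from that(1) have "s = map flip_y a @ map flip_y b"
        by (metis flip_simps(8) list.map_comp list.map_id map_append)
      then have "xsum (map flip_y a) > 0"
        using s \<open>a \<noteq> []\<close> unfolding bridge_def half_space_def by blast
      then show ?thesis by simp
    qed
    moreover have "xsum b \<ge> 0" if "map flip_y s = a @ b" for a b
    proof -
      from that have "s = map flip_y a @ map flip_y b"
        by (metis flip_simps(8) list.map_comp list.map_id map_append)
      then have "xsum (map flip_y b) \<ge> 0"
        using s unfolding bridge_def by blast
      then show ?thesis by simp
    qed
    ultimately show ?thesis
      unfolding bridge_def half_space_def by blast
  qed
  then have "map flip_y s \<in> bridges n" if "s \<in> bridges n" for s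
    using that self_avoiding_flip(2)[of s] flip_in_steps(2)[of s]
    by (simp add: bridges_def sa_walks_def)
  then have "bridges n \<subseteq> blocks n \<union> map flip_y ` blocks n"
    by (auto simp: blocks_def intro!: rev_image_eqI[of "map flip_y _"])
  then have "card (bridges n) \<le> card (blocks n \<union> map flip_y ` blocks n)"
    by (intro card_mono) (auto simp: blocks_def)
  also have "\<dots> \<le> card (blocks n) + card (blocks n)"
    by (intro order.trans[OF card_Un_le] add_mono card_image_le) (auto simp: blocks_def)
  finally show ?thesis by simp
qed

lemma bridge_append:
  assumes "bridge u" "bridge v" shows "bridge (u @ v)"
proof -
  have "xsum u \<ge> 0" using assms(1) unfolding bridge_def by (metis append_Nil)
  have "xsum v \<ge> 0" using assms(2) unfolding bridge_def by (metis append_Nil)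
  have "xsum a > 0" if "u @ v = a @ b" "a \<noteq> []" for a b
  proof -
    from that(1) consider e where "u = a @ e" | e where "a = u @ e" "v = e @ b"
      by (auto simp: append_eq_append_conv2)
    then show ?thesis
    proof cases
      case 1
      then show ?thesis using that assms(1) by (auto simp: bridge_def half_space_def)
    next
      case 2
      show ?thesis
      proof (cases "e = []")
        case True
        then show ?thesis using 2 that assms(1) unfolding bridge_def half_space_def by (metis append_Nil2)
      next
        case False
        then have "xsum e > 0" using 2 assms(2) by (auto simp: bridge_def half_space_def)
        then show ?thesis using 2 \<open>xsum u \<ge> 0\<close> by simp
      qed
    qed
  qed
  moreover have "xsum b \<ge> 0" if "u @ v = a @ b" for a b
  proof -
    from that consider e where "u = a @ e" "b = e @ v" | e where "v = e @ b"
      by (auto simp: append_eq_append_conv2)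
    then show ?thesis
    proof cases
      case 1
      then have "xsum e \<ge> 0" using assms(1) by (auto simp: bridge_def)
      then show ?thesis using 1 \<open>xsum v \<ge> 0\<close> by simp
    next
      case 2
      then show ?thesis using assms(2) by (auto simp: bridge_def)
    qed
  qed
  ultimately show ?thesis by (auto simp: bridge_def half_space_def)
qed

text \<open>A factor across the junction has positive x displacement. The assumption on
  \<open>u\<close> is the suffix condition alone so that \<open>u\<close> can also be the vertical
  initial segment of a block walk.\<close>

lemma self_avoiding_bridge_append:
  assumes "self_avoiding u" "self_avoiding v" "\<And>a b. u = a @ b \<Longrightarrow> xsum b \<ge> 0" "half_space v"
  shows "self_avoiding (u @ v)"
proof (rule self_avoiding_appendI[OF assms(1,2)])
  fix a b c d assume "u = a @ b" "v = c @ d" "c \<noteq> []"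
  then have "xsum b \<ge> 0" "xsum c > 0"
    using assms(3,4) by (auto simp: half_space_def)
  then show "sum_list b + sum_list c \<noteq> 0"
    by (auto simp: sum_list_prod_eq zero_prod_def)
qed

text \<open>For the height bound: every block begins at height at least 0, as the earlier ones end
  no lower than they start, and within its \<open>n\<close> steps it descends by at most
  \<open>n\<close>.\<close>

lemma concat_blocks:
  assumes "set ws \<subseteq> blocks n"
  shows "set (concat ws) \<subseteq> steps" "length (concat ws) = n * length ws"
    "self_avoiding (concat ws)" "bridge (concat ws)"
    "\<And>a b. concat ws = a @ b \<Longrightarrow> ysum a \<ge> - int n"
proof -
  have "set (concat ws) \<subseteq> steps \<and> length (concat ws) = n * length ws \<and>
    self_avoiding (concat ws) \<and> bridge (concat ws)"
    using assms
  proof (induction ws)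
    case Nil
    then show ?case by (simp add: bridge_def half_space_def)
  next
    case (Cons w ws)
    then show ?case
      by (auto simp: blocks_def bridges_def sa_walks_def bridge_append
          intro!: self_avoiding_bridge_append) (auto simp: bridge_def)
  qed
  then show "set (concat ws) \<subseteq> steps" "length (concat ws) = n * length ws"
    "self_avoiding (concat ws)" "bridge (concat ws)" by auto
  show "\<And>a b. concat ws = a @ b \<Longrightarrow> ysum a \<ge> - int n"
    using assms
  proof (induction ws)
    case (Cons w ws)
    have w: "length w = n" "ysum w \<ge> 0" "set w \<subseteq> steps"
      using Cons.prems by (auto simp: blocks_def bridges_def sa_walks_def)
    from Cons.prems(1) consider e where "w = a @ e" | e where "a = w @ e" "concat ws = e @ b"
      by (auto simp: append_eq_append_conv2)
    then show ?case
    proof cases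
      case 1
      have "set a \<subseteq> steps" "length a \<le> n" using 1 w by auto
      moreover have "ysum a \<ge> - int (length a)" if "set a \<subseteq> steps" for a
        using that by (induction a) (auto simp: steps_def)
      ultimately show ?thesis by (smt (verit) of_nat_mono)
    next
      case 2
      then show ?thesis using Cons.IH[of e b] Cons.prems(2) w by auto
    qed
  qed simp
qed

section \<open>Walks in the lattice\<close>

fun walk_from :: "int \<times> int \<Rightarrow> (int \<times> int) list \<Rightarrow> (int \<times> int) list" where
  "walk_from v [] = [v]"
| "walk_from v (x # s) = v # walk_from (v + x) s"

lemma walk_from_not_Nil [simp]: "walk_from v s \<noteq> []"
  by (cases s) auto

lemma length_walk_from [simp]: "length (walk_from v s) = Suc (length s)"
  by (induction s arbitrary: v) auto

lemma hd_walk_from [simp]: "hd (walk_from v s) = v"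
  by (cases s) auto

lemma set_walk_from: "set (walk_from v s) = {v + sum_list a | a b. s = a @ b}"
proof (induction s arbitrary: v)
  case (Cons x s)
  have "{v + sum_list a | a b. x # s = a @ b} = insert v {v + (x + sum_list a) | a b. s = a @ b}"
  proof (intro equalityI subsetI)
    fix w assume "w \<in> {v + sum_list a | a b. x # s = a @ b}"
    then obtain a b where "x # s = a @ b" "w = v + sum_list a" by blast
    then show "w \<in> insert v {v + (x + sum_list a) | a b. s = a @ b}"
      by (cases a) auto
  next
    fix w assume "w \<in> insert v {v + (x + sum_list a) | a b. s = a @ b}"
    then consider "w = v" | a b where "w = v + (x + sum_list a)" "s = a @ b" by blast
    then show "w \<in> {v + sum_list a | a b. x # s = a @ b}"
    proof cases
      case 1
      then have "w = v + sum_list []" "x # s = [] @ x # s" by simp_all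
      then show ?thesis by blast
    next
      case 2
      then have "w = v + sum_list (x # a)" "x # s = (x # a) @ b" by simp_all
      then show ?thesis by blast
    qed
  qed
  then show ?case by (simp add: Cons add.assoc)
qed auto

lemma take_walk_from: "take (Suc n) (walk_from v s) = walk_from v (take n s)"
  by (induction s arbitrary: v n) (auto simp: take_Cons split: nat.split)

lemma walk_from_inject [simp]: "walk_from v s = walk_from v t \<longleftrightarrow> s = t"
proof (induction s arbitrary: v t)
  case Nil
  then show ?case by (cases t) (auto simp: walk_from_not_Nil[symmetric] simp del: walk_from_not_Nil)
next
  case (Cons x s)
  show ?case
  proof (cases t)
    case (Cons y t')
    have "x = y" if "walk_from (v + x) s = walk_from (v + y) t'"
      using arg_cong[OF that, of hd] by simp
    then show ?thesis using Cons Cons.IH[of "v + y" t'] by auto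
  qed auto
qed

lemma walk_from_surj: "p \<noteq> [] \<Longrightarrow> \<exists>s. p = walk_from (hd p) s"
proof (induction p)
  case (Cons v p)
  show ?case
  proof (cases "p = []")
    case True
    then show ?thesis by (intro exI[of _ "[]"]) simp
  next
    case False
    then obtain s where "p = walk_from (hd p) s" using Cons.IH by blast
    then show ?thesis by (intro exI[of _ "(hd p - v) # s"]) simp
  qed
qed simp

text \<open>Matches the recursion of \<open>distinct\<close>: factors beginning with the first
  letter express that the starting vertex is not revisited.\<close>

lemma self_avoiding_Cons:
  "self_avoiding (x # s) \<longleftrightarrow> self_avoiding s \<and> (\<forall>a b. s = a @ b \<longrightarrow> x + sum_list a \<noteq> 0)"
  (is "_ \<longleftrightarrow> ?R")
proof
  assume *: "self_avoiding (x # s)"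
  then have "self_avoiding s"
    using self_avoiding_suffix[of "[x]" s] by simp
  moreover have "x + sum_list a \<noteq> 0" if "s = a @ b" for a b
  proof -
    have "x # s = [] @ (x # a) @ b" using that by simp
    then have "sum_list (x # a) \<noteq> 0"
      using * unfolding self_avoiding_def by blast
    then show ?thesis by simp
  qed
  ultimately show ?R by blast
next
  assume *: ?R
  have "self_avoiding ([x] @ s)"
  proof (rule self_avoiding_appendI)
    have "x \<noteq> 0" using * by force
    then show "self_avoiding [x]"
      by (auto simp: self_avoiding_def Cons_eq_append_conv)
    fix a b c d assume "[x] = a @ b" "s = c @ d" "b \<noteq> []"
    then have "b = [x]" by (auto simp: Cons_eq_append_conv)
    then show "sum_list b + sum_list c \<noteq> 0"
      using * \<open>s = c @ d\<close> by simp
  qed (use * in auto)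
  then show "self_avoiding (x # s)" by simp
qed

lemma distinct_walk_from: "distinct (walk_from v s) \<longleftrightarrow> self_avoiding s"
proof (induction s arbitrary: v)
  case (Cons x s)
  have "v \<notin> set (walk_from (v + x) s) \<longleftrightarrow> (\<forall>a b. s = a @ b \<longrightarrow> x + sum_list a \<noteq> 0)"
    by (auto simp: set_walk_from add.assoc)
  then show ?case
    by (auto simp: Cons self_avoiding_Cons)
qed simp

lemma lattice_adj_iff: "lattice_adj v (v + x) \<longleftrightarrow> x \<in> steps"
proof -
  obtain a b where "x = (a, b)" by (cases x)
  moreover have "\<bar>a\<bar> + \<bar>b\<bar> = 1 \<longleftrightarrow> (a = 1 \<or> a = - 1) \<and> b = 0 \<or> a = 0 \<and> (b = 1 \<or> b = - 1)"
    by arith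
  ultimately show ?thesis
    by (auto simp: lattice_adj_def steps_def)
qed

lemma successively_walk_from: "successively lattice_adj (walk_from v s) \<longleftrightarrow> set s \<subseteq> steps"
proof (induction s arbitrary: v)
  case (Cons x s)
  then show ?case
    by (simp add: successively_Cons lattice_adj_iff)
qed simp

lemma walk_from_in_saws_iff:
  "walk_from (0, 0) s \<in> saws G \<longleftrightarrow> set s \<subseteq> steps \<and> self_avoiding s \<and> (\<forall>a b. s = a @ b \<longrightarrow> sum_list a \<in> G)"
  by (auto simp: saws_def distinct_walk_from successively_walk_from set_walk_from zero_prod_def[symmetric])

lemma saw_eq_walk_from: "p \<in> saws G \<Longrightarrow> \<exists>s. p = walk_from (0, 0) s"
  using walk_from_surj[of p] by (auto simp: saws_def)

lemma saws_take:
  assumes "p \<in> saws G" "n > 0"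
  shows "take n p \<in> saws G"
  using assms successively_append_iff[of lattice_adj "take n p" "drop n p"]
  by (auto simp: saws_def dest: in_set_takeD)

lemma saw_count_eq: "saw_count n = card (sa_walks n)"
proof -
  have "{p \<in> saws UNIV. length p = n + 1} = walk_from (0, 0) ` sa_walks n"
  proof (intro equalityI subsetI)
    fix p assume p: "p \<in> {p \<in> saws UNIV. length p = n + 1}"
    then obtain s where "p = walk_from (0, 0) s" using saw_eq_walk_from by blast
    then show "p \<in> walk_from (0, 0) ` sa_walks n"
      using p by (auto simp: walk_from_in_saws_iff sa_walks_def)
  qed (auto simp: walk_from_in_saws_iff sa_walks_def)
  then show ?thesis
    unfolding saw_count_def by (simp add: card_image inj_on_def)
qed

lemma factor_replicate: "replicate n x = a @ b @ c \<Longrightarrow> b = replicate (length b) x"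
  by (rule replicate_eqI) (auto dest!: arg_cong[where f = set] split: if_splits)

text \<open>Horizontally this shows that walks of every length exist; vertically it provides the
  initial segment of the block walks.\<close>

lemma straight_walk:
  assumes "x \<in> steps" shows "replicate n x \<in> sa_walks n"
proof -
  have "sum_list b \<noteq> 0" if "replicate n x = a @ b @ c" "b \<noteq> []" for a b c
  proof -
    have "sum_list (replicate (length b) x) \<noteq> 0"
      using assms \<open>b \<noteq> []\<close> by (auto simp: sum_list_prod_eq sum_list_replicate steps_def zero_prod_def)
    then show ?thesis using factor_replicate[OF that(1)] by simp
  qed
  then show ?thesis using assms by (auto simp: sa_walks_def self_avoiding_def)
qed

section \<open>The connective constant\<close>

text \<open>Fekete's lemma for \<open>ln (c n)\<close>: the quotients \<open>a n / n\<close>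
  converge to their infimum, and that the limit is an infimum yields the lower bound on
  \<open>c n\<close> for every single \<open>n\<close>.\<close>

lemma submultiplicative_root_limit:
  fixes c :: "nat \<Rightarrow> real"
  assumes ge1: "\<And>n. c n \<ge> 1" and sub: "\<And>m n. c (m + n) \<le> c m * c n"
  obtains \<mu> where "\<mu> \<ge> 1" "(\<lambda>n. root n (c n)) \<longlonglongrightarrow> \<mu>" "\<And>n. n \<ge> 1 \<Longrightarrow> \<mu> ^ n \<le> c n"
proof -
  define a where "a n = ln (c n)" for n
  have cpos: "c n > 0" for n using ge1[of n] by linarith
  have a0: "a n \<ge> 0" for n using ge1 by (simp add: a_def)
  have asub: "a (m + n) \<le> a m + a n" for m n
  proof -
    have "ln (c (m + n)) \<le> ln (c m * c n)"
      using sub[of m n] cpos by simp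
    then show ?thesis
      using cpos[of m] cpos[of n] by (simp add: a_def ln_mult_pos)
  qed
  have amult: "a (q * k + r) \<le> real q * a k + a r" for q k r
  proof (induction q)
    case (Suc q)
    have "a (Suc q * k + r) \<le> a k + a (q * k + r)"
      using asub[of k "q * k + r"] by (simp add: add.assoc)
    with Suc show ?case by (simp add: algebra_simps)
  qed simp
  define m where "m = (INF n\<in>{1..}. a n / real n)"
  have bdd: "bdd_below ((\<lambda>n. a n / real n) ` {1..})"
    using a0 by (intro bdd_belowI[of _ 0]) auto
  have m_le: "m \<le> a n / real n" if "n \<ge> 1" for n
    unfolding m_def using bdd that by (intro cINF_lower) auto
  have m0: "m \<ge> 0"
    unfolding m_def using a0 by (intro cINF_greatest) auto
  have lim: "(\<lambda>n. a n / real n) \<longlonglongrightarrow> m"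
  proof (rule LIMSEQ_I)
    fix e :: real assume "e > 0"
    \<comment> \<open>An index nearly attaining the infimum. Division of \<open>n\<close> by
      \<open>k\<close> leaves a remainder term bounded by the constant \<open>M\<close> below,
      negligible after division by \<open>n\<close>.\<close>
    obtain k where k: "k \<ge> 1" "a k / real k < m + e / 2"
    proof -
      have "(INF n\<in>{1..}. a n / real n) < m + e / 2"
        unfolding m_def[symmetric] using \<open>e > 0\<close> by simp
      then show ?thesis
        using that bdd by (subst (asm) cINF_less_iff) auto
    qed
    define M where "M = (\<Sum>r<k. a r)"
    obtain N where N: "real N > 2 * M / e" using reals_Archimedean2 by blast
    show "\<exists>N. \<forall>n\<ge>N. norm (a n / real n - m) < e"
    proof (intro exI allI impI)
      fix n assume n: "n \<ge> Suc N"
      have "a n \<le> real (n div k) * a k + a (n mod k)"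
        using amult[of "n div k" k "n mod k"] by simp
      also have "a (n mod k) \<le> M"
        unfolding M_def using k a0 by (intro member_le_sum) auto
      also have "real (n div k) * a k \<le> real n / real k * a k"
      proof (intro mult_right_mono a0)
        have "real (n div k) * real k \<le> real n"
          using of_nat_mono[OF div_times_less_eq_dividend[of n k], where ?'a = real] by simp
        then show "real (n div k) \<le> real n / real k"
          using k by (simp add: le_divide_eq)
      qed
      finally have "a n / real n \<le> (real n / real k * a k + M) / real n"
        by (intro divide_right_mono) auto
      also have "\<dots> = a k / real k + M / real n"
        using n by (simp add: field_simps)
      also have "M / real n < e / 2"
      proof -
        have "2 * M / e < real n" using N n by linarith
        then show ?thesis using \<open>e > 0\<close> n by (simp add: field_simps)
      qed
      finally have "a n / real n < m + e" using k by simp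
      then show "norm (a n / real n - m) < e"
        using m_le[of n] n by auto
    qed
  qed
  have "exp m ^ n \<le> c n" if "n \<ge> 1" for n
  proof -
    have "exp m ^ n = exp (real n * m)" by (simp add: exp_of_nat_mult)
    also have "\<dots> \<le> exp (a n)"
      using m_le[OF that] that by (simp add: field_simps)
    finally show ?thesis using cpos by (simp add: a_def)
  qed
  moreover have "(\<lambda>n. root n (c n)) \<longlonglongrightarrow> exp m"
  proof (rule Lim_transform_eventually[OF tendsto_exp[OF lim]])
    show "\<forall>\<^sub>F n in sequentially. exp (a n / real n) = root n (c n)"
    proof (rule eventually_sequentiallyI[of 1])
      fix n :: nat assume "1 \<le> n"
      then have "ln (root n (c n)) = a n / real n"
        using cpos by (simp add: a_def ln_root)
      then show "exp (a n / real n) = root n (c n)"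
        using cpos[of n] \<open>1 \<le> n\<close> by (metis exp_ln real_root_gt_zero less_le_trans zero_less_one)
    qed
  qed
  ultimately show ?thesis using that[of "exp m"] m0 by simp
qed

lemma card_sa_walks_submultiplicative:
  "card (sa_walks (m + n)) \<le> card (sa_walks m) * card (sa_walks n)"
proof -
  have "card (sa_walks (m + n)) \<le> card (sa_walks m \<times> sa_walks n)"
  proof (rule card_inj_on_le[where f = "\<lambda>s. (take m s, drop m s)"])
    show "inj_on (\<lambda>s. (take m s, drop m s)) (sa_walks (m + n))"
      by (intro inj_onI) (metis append_take_drop_id prod.inject)
    show "(\<lambda>s. (take m s, drop m s)) ` sa_walks (m + n) \<subseteq> sa_walks m \<times> sa_walks n"
    proof clarify
      fix s assume s: "s \<in> sa_walks (m + n)"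
      then have sa: "self_avoiding (take m s @ drop m s)"
        by (simp add: sa_walks_def)
      show "take m s \<in> sa_walks m \<and> drop m s \<in> sa_walks n"
        using s self_avoiding_prefix[OF sa] self_avoiding_suffix[OF sa]
        by (auto simp: sa_walks_def dest: in_set_takeD in_set_dropD)
    qed
  qed simp
  then show ?thesis by (simp add: card_cartesian_product)
qed

lemma connective_constant:
  shows "connective_constant \<ge> 1"
    and "(\<lambda>n. root n (real (card (sa_walks n)))) \<longlonglongrightarrow> connective_constant"
    and "\<And>n. n \<ge> 1 \<Longrightarrow> connective_constant ^ n \<le> real (card (sa_walks n))"
proof -
  have "sa_walks n \<noteq> {}" for n
    using straight_walk[of "(1, 0)" n] by (auto simp: steps_def)
  then have "card (sa_walks n) \<ge> 1" for n
    by (simp add: Suc_le_eq card_gt_0_iff)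
  then have "real (card (sa_walks n)) \<ge> 1" for n
    by (simp add: real_of_nat_ge_one_iff)
  moreover have "real (card (sa_walks (m + n))) \<le> real (card (sa_walks m)) * real (card (sa_walks n))" for m n
    unfolding of_nat_mult[symmetric] of_nat_le_iff by (rule card_sa_walks_submultiplicative)
  ultimately obtain \<mu> where \<mu>: "\<mu> \<ge> 1" "(\<lambda>n. root n (real (card (sa_walks n)))) \<longlonglongrightarrow> \<mu>"
    "\<And>n. n \<ge> 1 \<Longrightarrow> \<mu> ^ n \<le> real (card (sa_walks n))"
    by (rule submultiplicative_root_limit) blast
  have eq: "connective_constant = \<mu>"
    unfolding connective_constant_def saw_count_eq using \<mu>(2) by (rule limI)
  show "connective_constant \<ge> 1"
    "(\<lambda>n. root n (real (card (sa_walks n)))) \<longlonglongrightarrow> connective_constant"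
    "\<And>n. n \<ge> 1 \<Longrightarrow> connective_constant ^ n \<le> real (card (sa_walks n))"
    unfolding eq by (rule \<mu>; assumption?)+
qed

section \<open>The critical value\<close>

lemma saw_tree_recurrent:
  assumes G: "quadrant \<subseteq> G" and l: "0 < l" "l * connective_constant < 1"
  shows "rw_recurrent (saw_tree G) l"
proof -
  interpret rooted_tree "saw_tree G"
    using G by (intro rooted_tree_saw_tree) (auto simp: quadrant_def)
  let ?c = "\<lambda>n. real (card (sa_walks n))"
  let ?L = "\<lambda>n. {x \<in> tverts (saw_tree G). length x - 1 = n}"
  have sub: "?L n \<subseteq> walk_from (0, 0) ` sa_walks n" for n
  proof
    fix p assume p: "p \<in> ?L n"
    then obtain s where "p = walk_from (0, 0) s" using saw_eq_walk_from[of p G] by auto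
    then show "p \<in> walk_from (0, 0) ` sa_walks n"
      using p by (auto simp: walk_from_in_saws_iff sa_walks_def)
  qed
  have fin: "finite (?L n)" for n
    by (rule finite_subset[OF sub]) simp
  have card_L: "card (?L n) \<le> card (sa_walks n)" for n
    using card_mono[OF _ sub] card_image_le[of "sa_walks n" "walk_from (0, 0)"]
    by (meson finite_imageI finite_sa_walks le_trans)
  have "connective_constant < 1 / l" using l by (simp add: field_simps)
  \<comment> \<open>Room between the growth rate and \<open>1 / l\<close>: eventually level
    \<open>n\<close> has at most \<open>r ^ n\<close> vertices, and
    \<open>r * l < 1\<close>.\<close>
  then obtain r where r: "connective_constant < r" "r < 1 / l"
    using dense by blast
  have r0: "r > 0" using r(1) connective_constant(1) by simp
  have "\<forall>\<^sub>F n in sequentially. root n (?c n) < r"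
    by (rule order_tendstoD(2)[OF connective_constant(2) r(1)])
  then have ev: "\<forall>\<^sub>F n in sequentially. norm (real (card (?L n)) * l ^ n) \<le> (r * l) ^ n"
    using eventually_gt_at_top[of 0]
  proof eventually_elim
    case (elim n)
    have "real (card (?L n)) \<le> ?c n" using card_L by simp
    also have "?c n = root n (?c n) ^ n" using elim by simp
    also have "\<dots> \<le> r ^ n" using elim by (intro power_mono) auto
    finally show ?case using l by (simp add: power_mult_distrib)
  qed
  have "(\<lambda>n. (r * l) ^ n) \<longlonglongrightarrow> 0"
    using r r0 l by (intro LIMSEQ_power_zero) (auto simp: field_simps abs_mult)
  then have lim: "(\<lambda>n. real (card (?L n)) * l ^ n) \<longlonglongrightarrow> 0"
    by (rule Lim_null_comparison[OF ev])
  show ?thesis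
  proof (rule recurrent_if_conductance_tendsto_0[OF _ _ l(1) _ _ fin lim])
    show "locally_finite_tree (saw_tree G)" by (rule locally_finite_saw_tree)
    show "infinite_tree (saw_tree G)" by (rule infinite_saw_tree) fact
    show "(length x - 1 = 0) = (x = troot (saw_tree G))" if "x \<in> tverts (saw_tree G)" for x
      using that saws_singleton_iff[of x G] by (cases x) (auto simp: saws_def)
    show "length y - 1 = Suc (length x - 1)"
      if "x \<in> tverts (saw_tree G)" "y \<in> children (saw_tree G) x" for x y
      using that by (cases x) (auto simp: children_saw_tree saws_def)
  qed
qed

section \<open>The uniform flow through concatenations of blocks\<close>

context
  fixes N :: nat
  assumes N: "N \<ge> 1" and blocks_nonempty: "blocks N \<noteq> {}"
begin

text \<open>Going up \<open>N\<close> steps first keeps every concatenation of blocks of length \<open>N\<close> in the quadrant.\<close>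

definition block_walk :: "(int \<times> int) list list \<Rightarrow> (int \<times> int) list" where
  "block_walk ws = walk_from (0, 0) (replicate N (0, 1) @ concat ws)"

definition block_words :: "nat \<Rightarrow> (int \<times> int) list \<Rightarrow> (int \<times> int) list list set" where
  "block_words m p = {ws. set ws \<subseteq> blocks N \<and> length ws = m \<and> take (length p) (block_walk ws) = p}"

text \<open>Probability that the walk along uniformly random blocks begins with \<open>p\<close>.
  Any number of blocks long enough to cover \<open>p\<close> gives the same value;
  \<open>length p\<close> blocks are enough because \<open>N \<ge> 1\<close>.\<close>

definition block_flow :: "(int \<times> int) list \<Rightarrow> real" where
  "block_flow p = real (card (block_words (length p) p)) / real (card (blocks N)) ^ length p"

lemma card_blocks_pos: "card (blocks N) > 0"
  using blocks_nonempty by (simp add: card_gt_0_iff)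

lemma finite_block_words [simp]: "finite (block_words m p)"
  by (rule finite_subset[OF _ finite_lists_length_eq[OF finite_blocks[of N], of m]])
     (auto simp: block_words_def)

lemma length_block_walk:
  assumes "set ws \<subseteq> blocks N" shows "length (block_walk ws) = Suc (N + N * length ws)"
  using concat_blocks(2)[OF assms] by (simp add: block_walk_def)

text \<open>The vertical segment is followed by a bridge, which moves strictly to the right of it.
  The blocks descend by at most \<open>N\<close>, exactly the height gained first.\<close>

lemma block_walk_in_saws:
  assumes G: "quadrant \<subseteq> G" and ws: "set ws \<subseteq> blocks N"
  shows "block_walk ws \<in> saws G"
proof -
  note c = concat_blocks[OF ws]
  let ?u = "replicate N (0, 1) :: (int \<times> int) list"
  have u: "?u \<in> sa_walks N" by (rule straight_walk) (simp add: steps_def)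
  have xy: "xsum (replicate k (0, 1)) = 0" "ysum (replicate k (0, 1)) = int k" for k
    by (simp_all add: sum_list_replicate)
  have split_u: "a = replicate (length a) (0, 1) \<and> b = replicate (length b) (0, 1)"
    if "?u = a @ b" for a b :: "(int \<times> int) list"
    using factor_replicate[of N "(0, 1)" "[]" a b] factor_replicate[of N "(0, 1)" a b "[]"] that by simp
  have "self_avoiding (?u @ concat ws)"
  proof (rule self_avoiding_bridge_append)
    show "self_avoiding ?u" using u by (simp add: sa_walks_def)
    show "self_avoiding (concat ws)" "half_space (concat ws)"
      using c by (auto simp: bridge_def)
    show "xsum b \<ge> 0" if "?u = a @ b" for a b
      using split_u[OF that] xy(1)[of "length b"] by simp
  qed
  moreover have "sum_list a \<in> G" if "?u @ concat ws = a @ b" for a b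
  proof -
    from that consider e where "?u = a @ e" | e where "a = ?u @ e" "concat ws = e @ b"
      by (auto simp: append_eq_append_conv2)
    then have "xsum a \<ge> 0 \<and> ysum a \<ge> 0"
    proof cases
      case 1
      then show ?thesis
        using split_u[OF 1] xy[of "length a"] by simp
    next
      case 2
      have "xsum e \<ge> 0"
        using 2 c(4) by (cases "e = []") (force simp: bridge_def half_space_def)+
      moreover have "ysum e \<ge> - int N"
        using c(5) 2 by blast
      ultimately show ?thesis
        using 2 xy[of N] by simp
    qed
    then show ?thesis
      using G by (auto simp: sum_list_prod_eq quadrant_def)
  qed
  ultimately show ?thesis
    using u c(1) by (auto simp: block_walk_def walk_from_in_saws_iff sa_walks_def)
qed

text \<open>If \<open>m\<close> blocks already cover \<open>p\<close>, a further block is a free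
  choice.\<close>

lemma card_block_words_Suc:
  assumes p: "length p > 0" "length p \<le> Suc (N + N * m)"
  shows "card (block_words (Suc m) p) = card (block_words m p) * card (blocks N)"
proof -
  obtain k where k: "length p = Suc k" using p by (cases p) auto
  have tk: "take (length p) (block_walk (ws @ [w])) = take (length p) (block_walk ws)"
    if "set ws \<subseteq> blocks N" "length ws = m" for ws w
    using concat_blocks(2)[OF that(1)] that p unfolding k block_walk_def take_walk_from
    by simp
  have "block_words (Suc m) p = (\<lambda>(ws, w). ws @ [w]) ` (block_words m p \<times> blocks N)"
  proof (intro equalityI subsetI)
    fix vs assume vs: "vs \<in> block_words (Suc m) p"
    then have "vs \<noteq> []" by (auto simp: block_words_def)
    then obtain ws w where ws: "vs = ws @ [w]" by (metis append_butlast_last_id)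
    then have "(ws, w) \<in> block_words m p \<times> blocks N"
      using vs tk[of ws w] by (auto simp: block_words_def)
    then show "vs \<in> (\<lambda>(ws, w). ws @ [w]) ` (block_words m p \<times> blocks N)"
      using ws by (intro image_eqI[of _ _ "(ws, w)"]) auto
  next
    fix vs assume "vs \<in> (\<lambda>(ws, w). ws @ [w]) ` (block_words m p \<times> blocks N)"
    then obtain ws w where "vs = ws @ [w]" "ws \<in> block_words m p" "w \<in> blocks N" by auto
    then show "vs \<in> block_words (Suc m) p"
      using tk[of ws w] by (auto simp: block_words_def)
  qed
  then have "card (block_words (Suc m) p) = card (block_words m p \<times> blocks N)"
    by (simp add: card_image inj_on_def)
  then show ?thesis by (simp add: card_cartesian_product)
qed

text \<open>Every word whose walk begins with \<open>p\<close> continues to some child of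
  \<open>p\<close>. Both sides are compared on words of \<open>Suc (length p)\<close>
  blocks.\<close>

lemma block_flow_children:
  assumes G: "quadrant \<subseteq> G" and p: "p \<in> saws G"
  shows "block_flow p \<le> (\<Sum>c\<in>children (saw_tree G) p. block_flow c)"
proof -
  let ?C = "children (saw_tree G) p" and ?b = "real (card (blocks N))"
  have p0: "length p > 0" using p by (auto simp: saws_def)
  \<comment> \<open>Since \<open>N \<ge> 1\<close>, the block walks are long enough to contain
    \<open>p\<close>, and with one more block also the vertex after it.\<close>
  have le: "Suc (length p) \<le> Suc (N + N * Suc (length p))" "length p \<le> Suc (N + N * length p)"
    using N by (simp_all add: le_SucI trans_le_add2)
  have finC: "finite ?C"
    using locally_finite_saw_tree[of G] p by (simp add: locally_finite_tree_def)
  have lenC: "length c = Suc (length p)" if "c \<in> ?C" for c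
    using that p by (auto simp: children_saw_tree)
  have "block_words (Suc (length p)) p \<subseteq> (\<Union>c\<in>?C. block_words (Suc (length p)) c)"
  proof
    fix ws assume "ws \<in> block_words (Suc (length p)) p"
    then have ws: "set ws \<subseteq> blocks N" "length ws = Suc (length p)" "take (length p) (block_walk ws) = p"
      by (auto simp: block_words_def)
    define c where "c = take (Suc (length p)) (block_walk ws)"
    have len: "length c = Suc (length p)"
      using length_block_walk[OF ws(1)] le(1) ws(2) by (simp add: c_def)
    have "c \<in> saws G"
      unfolding c_def using block_walk_in_saws[OF G ws(1)] by (intro saws_take) auto
    moreover have "butlast c = p"
      using ws(3) len by (simp add: butlast_conv_take) (simp add: c_def min_def)
    moreover have "c \<noteq> [(0, 0)]" using len p0 by auto
    ultimately have "c \<in> ?C" by (auto simp: children_def)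
    moreover have "ws \<in> block_words (Suc (length p)) c"
      using ws len by (simp add: block_words_def) (simp add: c_def)
    ultimately show "ws \<in> (\<Union>c\<in>?C. block_words (Suc (length p)) c)" by blast
  qed
  then have "card (block_words (Suc (length p)) p) \<le> card (\<Union>c\<in>?C. block_words (Suc (length p)) c)"
    using finC by (intro card_mono) auto
  also have "\<dots> \<le> (\<Sum>c\<in>?C. card (block_words (Suc (length p)) c))"
    using finC by (rule card_UN_le)
  finally have *: "card (block_words (length p) p) * card (blocks N) \<le>
      (\<Sum>c\<in>?C. card (block_words (Suc (length p)) c))"
    using card_block_words_Suc[OF p0 le(2)] by simp
  have "block_flow p = real (card (block_words (length p) p) * card (blocks N)) / ?b ^ Suc (length p)"
    using blocks_nonempty by (simp add: block_flow_def)
  also have "\<dots> \<le> real (\<Sum>c\<in>?C. card (block_words (Suc (length p)) c)) / ?b ^ Suc (length p)"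
    by (intro divide_right_mono of_nat_mono *) auto
  also have "\<dots> = (\<Sum>c\<in>?C. block_flow c)"
    unfolding of_nat_sum sum_divide_distrib by (intro sum.cong refl) (simp add: block_flow_def lenC)
  finally show ?thesis .
qed

text \<open>Once \<open>p\<close> covers the vertical segment and \<open>j\<close> whole blocks,
  these \<open>j\<close> blocks can be read off from \<open>p\<close>, all blocks having length
  \<open>N\<close>; only the other \<open>m - j\<close> are free.\<close>

lemma card_block_words_le:
  assumes "j \<le> m" "j = 0 \<or> length p \<ge> Suc (N + N * j)"
  shows "card (block_words m p) \<le> card (blocks N) ^ (m - j)"
proof -
  have "inj_on (drop j) (block_words m p)"
  proof (rule inj_onI)
    fix ws vs assume *: "ws \<in> block_words m p" "vs \<in> block_words m p" "drop j ws = drop j vs"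
    then have b: "set ws \<subseteq> blocks N" "set vs \<subseteq> blocks N" "length ws = m" "length vs = m"
      "take (length p) (block_walk ws) = take (length p) (block_walk vs)"
      by (auto simp: block_words_def)
    have len: "length w = N" if "w \<in> set ws \<union> set vs" for w
      using b that by (auto simp: blocks_def bridges_def sa_walks_def)
    have "take j ws = take j vs"
    proof (cases "j = 0")
      case False
      then obtain k where k: "length p = Suc k" "N + N * j \<le> k"
        using assms(2) by (cases "length p") auto
      have cj: "take (N * j) (concat us) = concat (take j us)"
        if "set us \<subseteq> blocks N" "length us = m" for us
      proof -
        have "set (take j us) \<subseteq> blocks N" using that(1) by (auto dest: in_set_takeD)
        then have "length (concat (take j us)) = N * j"
          using concat_blocks(2)[of "take j us" N] that(2) assms(1) by simp
        moreover have "concat us = concat (take j us) @ concat (drop j us)"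
          by (metis append_take_drop_id concat_append)
        ultimately show ?thesis by simp
      qed
      have "take (k - N) (concat ws) = take (k - N) (concat vs)"
        using b(5) k unfolding block_walk_def k(1) take_walk_from by simp
      then have "take (N * j) (take (k - N) (concat ws)) = take (N * j) (take (k - N) (concat vs))"
        by simp
      moreover have "min (N * j) (k - N) = N * j"
        using k(2) by simp
      ultimately have "concat (take j ws) = concat (take j vs)"
        using cj b by (simp add: take_take)
      moreover have "\<forall>(x, y)\<in>set (zip (take j ws) (take j vs)). length x = length y"
        using len by (metis (mono_tags, lifting) UnCI case_prodI2 in_set_takeD set_zip_leftD set_zip_rightD)
      ultimately show ?thesis
        using b by (intro concat_injective) auto
    qed simp
    then show "ws = vs" using *(3) by (metis append_take_drop_id)
  qed
  moreover have "drop j ` block_words m p \<subseteq> {ws. set ws \<subseteq> blocks N \<and> length ws = m - j}"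
    by (auto simp: block_words_def dest: in_set_dropD)
  ultimately have "card (block_words m p) \<le> card {ws. set ws \<subseteq> blocks N \<and> length ws = m - j}"
    by (intro card_inj_on_le) (auto simp: finite_lists_length_eq)
  then show ?thesis by (simp add: card_lists_length_eq)
qed

text \<open>Each block determined by \<open>p\<close> costs a factor \<open>r ^ N\<close>. The
  constant \<open>r ^ (2 * N)\<close> pays for the vertical segment and for the last, incomplete
  block.\<close>

lemma block_flow_le:
  assumes r: "r \<ge> 1" "r ^ N = real (card (blocks N))" and p: "length p = Suc i"
  shows "block_flow p \<le> r ^ (2 * N) / r ^ i"
proof -
  \<comment> \<open>Number of whole blocks within the first \<open>i\<close> steps; truncated
    subtraction makes it 0 inside the vertical segment.\<close>
  define j where "j = (i - N) div N"
  have "j \<le> i" unfolding j_def by (meson diff_le_self div_le_dividend le_trans)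
  have j: "j = 0 \<or> length p \<ge> Suc (N + N * j)"
  proof (cases "i < N")
    case True
    then show ?thesis by (simp add: j_def)
  next
    case False
    moreover have "N * j \<le> i - N" by (simp add: j_def)
    ultimately have "Suc (N + N * j) \<le> length p" using p by linarith
    then show ?thesis ..
  qed
  have i: "i \<le> 2 * N + N * j"
  proof -
    have "i - N = N * j + (i - N) mod N" by (simp add: j_def)
    moreover have "(i - N) mod N < N" using N by simp
    ultimately show ?thesis by linarith
  qed
  let ?b = "real (card (blocks N))"
  have "real (card (block_words (Suc i) p)) \<le> ?b ^ (Suc i - j)"
    using card_block_words_le[of j "Suc i" p] j \<open>j \<le> i\<close> by (metis le_SucI of_nat_le_iff of_nat_power)
  then have "block_flow p \<le> ?b ^ (Suc i - j) / ?b ^ Suc i"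
    unfolding block_flow_def p by (intro divide_right_mono) auto
  also have "\<dots> = 1 / ?b ^ j"
  proof -
    have "?b ^ Suc i = ?b ^ (Suc i - j) * ?b ^ j"
      using \<open>j \<le> i\<close> by (simp flip: power_add)
    then show ?thesis using blocks_nonempty by simp
  qed
  also have "\<dots> = r ^ (2 * N) / r ^ (2 * N + N * j)"
    using r by (simp add: power_add power_mult)
  also have "\<dots> \<le> r ^ (2 * N) / r ^ i"
    using r i by (intro divide_left_mono power_increasing mult_pos_pos zero_less_power) auto
  finally show ?thesis .
qed

lemma block_flow_root: "block_flow [(0, 0)] = 1"
proof -
  have "block_words 1 [(0, 0)] = {ws. set ws \<subseteq> blocks N \<and> length ws = 1}"
    using take_walk_from[of 0 "(0, 0)"] by (auto simp: block_words_def block_walk_def)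
  then show ?thesis
    using blocks_nonempty by (simp add: block_flow_def card_lists_length_eq)
qed

lemma block_flow_nonneg: "block_flow p \<ge> 0"
  by (simp add: block_flow_def)

text \<open>The potential of the flow \<^const>\<open>block_flow\<close> is bounded because on level \<open>i\<close> the flow is
  \<open>O(r ^ - i)\<close> with \<open>r * l > 1\<close>.\<close>

lemma saw_tree_transient_if_blocks:
  assumes G: "quadrant \<subseteq> G" and l: "l > 0" "real (card (blocks N)) * l ^ N > 1"
  shows "rw_transient (saw_tree G) l"
proof -
  interpret rooted_tree "saw_tree G"
    using G by (intro rooted_tree_saw_tree) (auto simp: quadrant_def)
  define r where "r = root N (real (card (blocks N)))"
  have b: "real (card (blocks N)) \<ge> 1"
    using card_blocks_pos by (simp add: real_of_nat_ge_one_iff Suc_le_eq)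
  have r: "r \<ge> 1" "r ^ N = real (card (blocks N))"
    using b N by (simp_all add: r_def)
  have rl: "r * l > 1"
  proof (rule ccontr)
    assume "\<not> r * l > 1"
    then have "(r * l) ^ N \<le> 1"
      using l r by (intro power_le_one) auto
    then show False
      using l r by (simp add: power_mult_distrib)
  qed
  define q where "q = 1 / (r * l)"
  have q: "0 < q" "q < 1" using rl by (auto simp: q_def)
  \<comment> \<open>Potential: flow times resistance, summed along the path from the root to
    \<open>p\<close>. The entry of \<open>take (Suc i) p\<close> into level \<open>i\<close> has
    resistance \<open>1 / l ^ i\<close>; the sum is empty at the root.\<close>
  define f where "f p = (\<Sum>i\<in>{1..<length p}. block_flow (take (Suc i) p) / l ^ i)" for p
  have f_snoc: "f (p @ [v]) = f p + block_flow (p @ [v]) / l ^ length p" if "p \<noteq> []" for p v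
    using that by (cases p) (auto simp: f_def intro!: sum.cong)
  have bound: "f p \<le> r ^ (2 * N) * (1 / (1 - q))" for p
  proof -
    have "f p \<le> (\<Sum>i\<in>{1..<length p}. r ^ (2 * N) * q ^ i)"
      unfolding f_def
    proof (intro sum_mono)
      fix i assume "i \<in> {1..<length p}"
      then have "block_flow (take (Suc i) p) / l ^ i \<le> r ^ (2 * N) / r ^ i / l ^ i"
        using l by (intro divide_right_mono block_flow_le r) auto
      then show "block_flow (take (Suc i) p) / l ^ i \<le> r ^ (2 * N) * q ^ i"
        by (simp add: q_def power_divide power_mult_distrib)
    qed
    also have "\<dots> \<le> r ^ (2 * N) * (\<Sum>i<length p. q ^ i)"
      unfolding sum_distrib_left[symmetric] using r q by (intro mult_left_mono sum_mono2) auto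
    also have "\<dots> \<le> r ^ (2 * N) * (1 / (1 - q))"
    proof (intro mult_left_mono)
      have "(\<Sum>i<length p. q ^ i) \<le> (\<Sum>i. q ^ i)"
        using q by (intro sum_le_suminf summable_geometric) auto
      then show "(\<Sum>i<length p. q ^ i) \<le> 1 / (1 - q)"
        using q by (simp add: suminf_geometric)
    qed (use r in auto)
    finally show ?thesis .
  qed
  have f_child: "f c - f p = block_flow c / l ^ length p" if "p \<in> saws G" "c \<in> children (saw_tree G) p" for p c
    using that f_snoc[of p] by (auto simp: children_saw_tree saws_def)
  show ?thesis
  proof (rule transient_if_bounded_subharmonic[where f = f, OF _ _ l(1) _ bound])
    show "locally_finite_tree (saw_tree G)" by (rule locally_finite_saw_tree)
    show "infinite_tree (saw_tree G)" by (rule infinite_saw_tree) fact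
    show "f (troot (saw_tree G)) = 0" by (simp add: f_def)
    show "0 \<le> f p" for p
      unfolding f_def using l by (intro sum_nonneg divide_nonneg_pos block_flow_nonneg) auto
    show "f p - f (tparent (saw_tree G) p) \<le> l * (\<Sum>c\<in>children (saw_tree G) p. f c - f p)"
      if p: "p \<in> tverts (saw_tree G)" "p \<noteq> troot (saw_tree G)" for p
    proof -
      have pG: "p \<in> saws G" "p \<noteq> [(0, 0)]" using p by auto
      have par: "butlast p \<in> saws G" "p \<in> children (saw_tree G) (butlast p)"
        using butlast_in_saws[OF pG] pG by (auto simp: children_def)
      have len: "length p = Suc (length (butlast p))"
        using pG by (cases p) (auto simp: saws_def)
      have "f p - f (butlast p) = block_flow p / l ^ length (butlast p)"
        by (rule f_child[OF par])
      \<comment> \<open>The children lie one level deeper, where the resistance is larger by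
        \<open>1 / l\<close>; the factor \<open>l\<close> in the subharmonic inequality compensates
        for this.\<close>
      also have "\<dots> = l * (block_flow p / l ^ length p)"
        unfolding len using l by simp
      also have "\<dots> \<le> l * ((\<Sum>c\<in>children (saw_tree G) p. block_flow c) / l ^ length p)"
        using l by (intro mult_left_mono divide_right_mono block_flow_children G pG) auto
      also have "\<dots> = l * (\<Sum>c\<in>children (saw_tree G) p. f c - f p)"
        unfolding sum_divide_distrib using f_child[OF pG(1)] by simp
      finally show ?thesis by simp
    qed
    have o: "[(0, 0)] \<in> saws G" using root_in by simp
    \<comment> \<open>The unit flow at the root is passed on to its children, so the potential
      cannot vanish on all of them.\<close>
    have "0 < block_flow [(0, 0)] / l" using l by (simp add: block_flow_root)
    also have "\<dots> \<le> (\<Sum>c\<in>children (saw_tree G) [(0, 0)]. block_flow c) / l"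
      using l by (intro divide_right_mono block_flow_children G o) auto
    also have "\<dots> = (\<Sum>c\<in>children (saw_tree G) [(0, 0)]. f c)"
      unfolding sum_divide_distrib
      by (intro sum.cong refl) (use f_child[OF o] in \<open>simp add: f_def\<close>)
    finally show "0 < (\<Sum>c\<in>children (saw_tree G) (troot (saw_tree G)). f c)" by simp
  qed
qed

end

text \<open>Bridges of a suitable length have weight above 2, and at least half of them are blocks,
  so their weight exceeds 1.\<close>

lemma saw_tree_transient:
  assumes G: "quadrant \<subseteq> G" and l: "l > 0" "l * connective_constant > 1"
  shows "rw_transient (saw_tree G) l"
proof -
  obtain N where N: "N \<ge> 1" "real (card (bridges N)) * l ^ N > 2"
    using many_bridges[OF connective_constant(3) l] by blast
  have "real (card (bridges N)) * l ^ N \<le> real (2 * card (blocks N)) * l ^ N"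
    using l card_bridges_le_blocks[of N] by (intro mult_right_mono of_nat_mono) auto
  then have blocks: "real (card (blocks N)) * l ^ N > 1"
    using N(2) by simp
  then have "blocks N \<noteq> {}" by auto
  then show ?thesis
    using saw_tree_transient_if_blocks[OF N(1) _ G l(1) blocks] by blast
qed

lemma is_critical_value_saw_tree:
  assumes "quadrant \<subseteq> G"
  shows "is_critical_value (saw_tree G) (1 / connective_constant)"
  unfolding is_critical_value_def
  using connective_constant(1) saw_tree_recurrent[OF assms] saw_tree_transient[OF assms]
  by (auto simp: field_simps)

theorem theorem1:
  shows "(\<forall>T \<in> {saw_tree UNIV, saw_tree half_plane, saw_tree quadrant}.
            is_critical_value T (critical_value T)) \<and>
         critical_value (saw_tree UNIV) = critical_value (saw_tree half_plane) \<and>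
         critical_value (saw_tree half_plane) = critical_value (saw_tree quadrant) \<and>
         critical_value (saw_tree quadrant) = 1 / connective_constant"
proof -
  have crit: "is_critical_value (saw_tree G) (1 / connective_constant)"
    "critical_value (saw_tree G) = 1 / connective_constant"
    if "G \<in> {UNIV, half_plane, quadrant}" for G
  proof -
    have "quadrant \<subseteq> G"
      using that by (auto simp: quadrant_def half_plane_def)
    then show "is_critical_value (saw_tree G) (1 / connective_constant)"
      by (rule is_critical_value_saw_tree)
    then show "critical_value (saw_tree G) = 1 / connective_constant"
      by (rule critical_value_eqI)
  qed
  then show ?thesis by simp
qed

end
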